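(* Let $\mu\in\mathbb{C}$. For all integers $m,n\ge 1$, the rational function $$w_{m,n}(z;\mu)=\frac{T_{m-1,n}^{(\mu)}(z)\,T_{m-1,n+1}^{(\mu)}(z)}{T_{m,n}^{(\mu)}(z)\,T_{m-2,n+1}^{(\mu)}(z)}$$ is a solution of the fifth Painlevé equation $\mathrm{P_V}$ with parameters $$\alpha=\tfrac12 m^2,\qquad \beta=-\tfrac12(m+2n+1+\mu)^2,\qquad \gamma=\mu .$$ In the case $n=0$, for every integer $m\ge1$ the rational function $$w_{m,0}(z;\mu)=\frac{T_{m-1,1}^{(\mu)}(z)}{T_{m-2,1}^{(\mu)}(z)}=\frac{L_m^{(\mu+1)}(z)}{L_{m-1}^{(\mu+1)}(z)}$$ is a solution of $\mathrm{P_V}$ with parameters $\alpha=\tfrac12m^2$, $\beta=-\tfrac12(m+1+\mu)^2$, $\gamma=\mu$.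
   Context: $L_n^{(\alpha)}(z)=\frac{z^{-\alpha}e^z}{n!}\frac{d^n}{dz^n}\left(z^{n+\alpha}e^{-z}\right)=\sum_{i=0}^n \frac{(-1)^i}{i!\,(n-i)!}\Big(\prod_{l=i+1}^{n}(\alpha+l)\Big)z^i$ is the associated Laguerre polynomial ($n\ge0$, any complex $\alpha$). The generalised Laguerre polynomial is $T_{m,n}^{(\mu)}(z)=\det\left[\frac{d^{j+k}}{dz^{j+k}}L_{m+n}^{(\mu+1)}(z)\right]_{j,k=0}^{n-1}$ for integers $m\ge0$, $n\ge1$; the same formula is used for $m=-1$ (when it gives a nonzero constant). $\mathrm{P_V}$ with parameters $\alpha,\beta,\gamma$ is $$\frac{d^2w}{dz^2}=\left(\frac1{2w}+\frac1{w-1}\right)\left(\frac{dw}{dz}\right)^2-\frac1z\frac{dw}{dz}+\frac{(w-1)^2(\alpha w^2+\beta)}{z^2w}+\frac{\gamma w}{z}-\frac{w(w+1)}{2(w-1)} .$$ *)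

theory Defs
  imports "HOL-Complex_Analysis.Complex_Analysis" "Jordan_Normal_Form.Determinant"
begin

definition laguerre :: "nat \<Rightarrow> complex \<Rightarrow> complex poly" where
  "laguerre n a = (\<Sum>i\<le>n. monom ((- 1) ^ i / (fact i * fact (n - i))
                              * (\<Prod>l\<in>{i+1..n}. a + of_nat l)) i)"

(* The first index is an integer because the value -1 is needed. Only m >= -1 and n >= 1
   are meaningful, and then m + n >= 0, so the conversion to nat loses nothing. *)
definition gen_laguerre :: "int \<Rightarrow> nat \<Rightarrow> complex \<Rightarrow> complex poly" where
  "gen_laguerre m n \<mu> =
     det (mat n n (\<lambda>(j, k). (pderiv ^^ (j + k)) (laguerre (nat (m + int n)) (\<mu> + 1))))"

definition PV_equation_at ::
    "complex \<Rightarrow> complex \<Rightarrow> complex \<Rightarrow> (complex \<Rightarrow> complex) \<Rightarrow> complex \<Rightarrow> bool" where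
  "PV_equation_at \<alpha> \<beta> \<gamma> w z \<longleftrightarrow>
     deriv (deriv w) z =
       (1 / (2 * w z) + 1 / (w z - 1)) * (deriv w z)\<^sup>2 - 1 / z * deriv w z
       + (w z - 1)\<^sup>2 * (\<alpha> * (w z)\<^sup>2 + \<beta>) / (z\<^sup>2 * w z)
       + \<gamma> * w z / z - w z * (w z + 1) / (2 * (w z - 1))"

(* Division by zero is total in HOL, so a solution is required to stay away from
   the singularities z = 0, w = 0 and w = 1 of the equation. *)
definition PV_solution_on ::
    "complex \<Rightarrow> complex \<Rightarrow> complex \<Rightarrow> complex set \<Rightarrow> (complex \<Rightarrow> complex) \<Rightarrow> bool" where
  "PV_solution_on \<alpha> \<beta> \<gamma> S w \<longleftrightarrow>
     open S \<and> w holomorphic_on S \<and>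
     (\<forall>z\<in>S. z \<noteq> 0 \<and> w z \<noteq> 0 \<and> w z \<noteq> 1 \<and> PV_equation_at \<alpha> \<beta> \<gamma> w z)"

(* The rational function p/q is a solution if it satisfies the equation at every point where
   q does not vanish and every term of the equation is defined. Finiteness of the exceptional
   set says that q is not the zero polynomial and that p/q is not identically 0 or 1. *)
definition PV_rational_solution ::
    "complex \<Rightarrow> complex \<Rightarrow> complex \<Rightarrow> complex poly \<Rightarrow> complex poly \<Rightarrow> bool" where
  "PV_rational_solution \<alpha> \<beta> \<gamma> p q \<longleftrightarrow>
     (let w = (\<lambda>z. poly p z / poly q z);
          S = {z. z \<noteq> 0 \<and> poly q z \<noteq> 0 \<and> w z \<noteq> 0 \<and> w z \<noteq> 1}
      in finite (- S) \<and> PV_solution_on \<alpha> \<beta> \<gamma> S w)"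

end

theory Submission
  imports Defs
begin

text \<open>
  Put \<open>N = m + n\<close>, \<open>a = \<mu> + 1\<close>, \<open>f = L\<^sub>N\<close>, \<open>g = L\<^sub>N\<^sub>-\<^sub>1\<close> (both with parameter \<open>a\<close>), and let \<open>\<tau>\<close>, \<open>\<rho>\<close>,
  \<open>\<sigma>\<close> be the sequences of Hankel determinants of the derivatives of \<open>f\<close>, \<open>g\<close>, \<open>f'\<close>. The function in question
  is \<open>w\<^sub>n = \<rho>\<^sub>n \<tau>\<^sub>n\<^sub>+\<^sub>1 / (\<tau>\<^sub>n \<rho>\<^sub>n\<^sub>+\<^sub>1)\<close>. Jacobi's identity for minors gives bilinear (Volterra lattice)
  relations between \<open>\<tau>\<close> and \<open>\<sigma>\<close>. Since \<open>f' = (D - 1) g\<close> and Hankel determinants do not change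
  when \<open>D\<close> is replaced by \<open>D - 1\<close>, similar relations connect \<open>\<rho>\<close> and \<open>\<sigma>\<close>. In terms of
  \<open>A\<^sub>n = z \<sigma>\<^sub>n\<^sub>+\<^sub>1 \<tau>\<^sub>n / (\<sigma>\<^sub>n \<tau>\<^sub>n\<^sub>+\<^sub>1)\<close> and \<open>B\<^sub>n = z \<sigma>\<^sub>n\<^sub>-\<^sub>1 \<rho>\<^sub>n\<^sub>+\<^sub>1 / (\<sigma>\<^sub>n \<rho>\<^sub>n)\<close> they say that
  \<open>z w\<^sub>n' = w\<^sub>n ((w\<^sub>n - 1) (B\<^sub>n - A\<^sub>n) - z)\<close> and give the passage from \<open>n\<close> to \<open>n + 1\<close>. Along this
  passage two further relations propagate from \<open>n = 0\<close>, where they hold by the ladder relation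
  \<open>z f' = N f - (N + a) g\<close>:
  \<open>A\<^sub>n + B\<^sub>n = m - k / w\<^sub>n\<close> and \<open>z B\<^sub>n' = (w\<^sub>n - 1) B\<^sub>n (m - B\<^sub>n) - z (B\<^sub>n + n) / (w\<^sub>n - 1)\<close>, with
  \<open>m = N - n\<close> and \<open>k = N + n + a\<close>. Eliminating \<open>A\<^sub>n\<close> and \<open>B\<^sub>n\<close> leaves the fifth Painleve equation.
\<close>

hide_const (open) Module.smult

subsection \<open>Minors\<close>

text \<open>\<open>V j\<close> is the column with index \<open>j\<close>, as a function of the row.
  Replacing a column is then the function update \<open>V(j := x)\<close>, which is the operation
  that all the determinant identities below use.\<close>

definition col_det :: "nat \<Rightarrow> (nat \<Rightarrow> nat \<Rightarrow> 'a :: comm_ring_1) \<Rightarrow> 'a" where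
  "col_det n V = det (mat n n (\<lambda>(i, j). V j i))"

definition unit_col :: "nat \<Rightarrow> nat \<Rightarrow> 'a :: comm_ring_1" where
  "unit_col r i = (if i = r then 1 else 0)"

lemma col_det_0 [simp]: "col_det 0 V = 1"
  by (simp add: col_det_def det_dim_zero)

lemma col_det_cong:
  assumes "\<And>i j. i < n \<Longrightarrow> j < n \<Longrightarrow> V j i = W j i"
  shows "col_det n V = col_det n W"
  unfolding col_det_def using assms by (intro arg_cong[of _ _ det] eq_matI) auto

text \<open>Cofactors along column \<open>k\<close> never see that column, so those of the
  unmodified matrix serve for every \<open>x\<close>: the determinant is a fixed linear functional
  of the column put in.\<close>

lemma col_det_laplace:
  assumes "k < n"
  shows "col_det n (V(k := x)) = (\<Sum>i<n. x i * cofactor (mat n n (\<lambda>(i, j). V j i)) i k)"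
proof -
  let ?A = "mat n n (\<lambda>(i, j). (V(k := x)) j i)"
  have "mat_delete ?A i k = mat_delete (mat n n (\<lambda>(i, j). V j i)) i k" if "i < n" for i
    unfolding mat_delete_def using that assms by (intro eq_matI) auto
  then have cof: "cofactor ?A i k = cofactor (mat n n (\<lambda>(i, j). V j i)) i k" if "i < n" for i
    using that by (simp add: cofactor_def)
  have "det ?A = (\<Sum>i<n. ?A $$ (i, k) * cofactor ?A i k)"
    using assms by (intro laplace_expansion_column) auto
  also have "\<dots> = (\<Sum>i<n. x i * cofactor (mat n n (\<lambda>(i, j). V j i)) i k)"
    using assms by (intro sum.cong refl) (simp add: cof fun_upd_same del: fun_upd_apply)
  finally show ?thesis by (simp add: col_det_def)
qed

text \<open>A unit column isolates one minor. Thus minors become full-size determinants with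
  replaced columns, to which \<open>col_det_jacobi\<close> applies.\<close>

lemma col_det_unit:
  assumes "k \<le> n" "r \<le> n"
  shows "col_det (Suc n) (V(k := unit_col r)) =
    (-1) ^ (r + k) * col_det n (\<lambda>j i. V (insert_index k j) (insert_index r i))"
proof -
  let ?A = "mat (Suc n) (Suc n) (\<lambda>(i, j). (V(k := unit_col r)) j i)"
  have "det ?A = (\<Sum>i<Suc n. ?A $$ (i, k) * cofactor ?A i k)"
    using assms by (intro laplace_expansion_column) auto
  also have "\<dots> = (\<Sum>i<Suc n. if i = r then cofactor ?A i k else 0)"
    using assms by (intro sum.cong) (auto simp: unit_col_def)
  also have "\<dots> = cofactor ?A r k"
    using assms by simp
  also have "\<dots> = (-1) ^ (r + k) * col_det n (\<lambda>j i. V (insert_index k j) (insert_index r i))"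
    unfolding cofactor_def col_det_def mat_delete_def
    by (intro arg_cong2[of _ _ _ _ "(*)"] refl arg_cong[of _ _ det] eq_matI)
      (auto simp: insert_index_def)
  finally show ?thesis by (simp add: col_det_def)
qed

lemma col_det_repeat:
  assumes "k < n" "l < n" "k \<noteq> l" "V k = V l"
  shows "col_det n V = 0"
  unfolding col_det_def
  by (rule det_identical_columns[OF _ assms(3,1,2)]) (use assms in \<open>auto intro!: eq_vecI\<close>)

lemma col_det_swap:
  assumes "k < n" "l < n" "k \<noteq> l"
  shows "col_det n (V(k := x, l := y)) = - col_det n (V(k := y, l := x))"
proof -
  let ?A = "mat n n (\<lambda>(i, j). (V(k := x, l := y)) j i)"
  have "col_det n (V(k := y, l := x)) = det (swapcols k l ?A)"
    unfolding col_det_def using assms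
    by (intro arg_cong[of _ _ det] eq_matI) auto
  also have "\<dots> = - det ?A"
    using assms by (intro det_swapcols) auto
  finally show ?thesis by (simp add: col_det_def)
qed

text \<open>Cramer's rule without division: both sides come from the product of the matrix with its
  adjugate, so the rule holds over any commutative ring and for singular matrices.\<close>

lemma col_det_cramer:
  assumes "i < n"
  shows "(\<Sum>j<n. col_det n (V(j := c)) * V j i) = col_det n V * c i"
proof -
  let ?A = "mat n n (\<lambda>(i, j). V j i)"
  have A: "?A \<in> carrier_mat n n" by simp
  have cof: "col_det n (V(j := c)) = (\<Sum>l<n. c l * cofactor ?A l j)" if "j < n" for j
    using that by (rule col_det_laplace)
  have adj: "(\<Sum>j<n. ?A $$ (i, j) * cofactor ?A l j) = (if i = l then det ?A else 0)"
    if "l < n" for l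
  proof -
    have "(?A * adj_mat ?A) $$ (i, l) = (\<Sum>j<n. ?A $$ (i, j) * cofactor ?A l j)"
      unfolding times_mat_def scalar_prod_def adj_mat_def using assms that
      by (auto intro!: sum.cong)
    then show ?thesis
      using adj_mat(2)[OF A] assms that by (cases "i = l") simp_all
  qed
  have "(\<Sum>j<n. col_det n (V(j := c)) * V j i) = (\<Sum>j<n. \<Sum>l<n. c l * (?A $$ (i, j) * cofactor ?A l j))"
    using assms by (auto simp: cof sum_distrib_right intro!: sum.cong)
  also have "\<dots> = (\<Sum>l<n. c l * (\<Sum>j<n. ?A $$ (i, j) * cofactor ?A l j))"
    by (subst sum.swap) (simp add: sum_distrib_left)
  also have "\<dots> = (\<Sum>l<n. if i = l then c l * det ?A else 0)"
    by (intro sum.cong refl) (subst adj, auto)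
  also have "\<dots> = det ?A * c i"
    using assms by simp
  finally show ?thesis by (simp add: col_det_def)
qed

text \<open>Cramer's rule writes \<open>col_det n V * c\<close> as a combination of the columns of
  \<open>V\<close>. Putting this into column \<open>k\<close> of the determinant whose column
  \<open>l\<close> is \<open>d\<close> leaves only the terms \<open>j = k\<close> and
  \<open>j = l\<close>, since every other one has a repeated column. For unit columns this is the
  Desnanot-Jacobi identity.\<close>

lemma col_det_jacobi:
  assumes "k < n" "l < n" "k \<noteq> l"
  shows "col_det n V * col_det n (V(k := c, l := d)) =
    col_det n (V(k := c)) * col_det n (V(l := d)) - col_det n (V(l := c)) * col_det n (V(k := d))"
proof -
  obtain C where C: "\<And>x. col_det n ((V(l := d))(k := x)) = (\<Sum>i<n. x i * C i)"
    using that col_det_laplace[OF assms(1), of "V(l := d)"] .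
  define G where "G x = (\<Sum>i<n. x i * C i)" for x
  have G: "G x = col_det n (V(k := x, l := d))" for x
    using C[of x] assms by (simp add: G_def fun_upd_twist)
  have "col_det n V * G c = (\<Sum>i<n. (col_det n V * c i) * C i)"
    by (simp add: G_def sum_distrib_left mult.assoc)
  also have "\<dots> = (\<Sum>i<n. (\<Sum>j<n. col_det n (V(j := c)) * V j i) * C i)"
    by (simp add: col_det_cramer)
  also have "\<dots> = (\<Sum>j<n. col_det n (V(j := c)) * G (V j))"
    unfolding sum_distrib_right
    by (subst sum.swap) (simp add: G_def sum_distrib_left mult.assoc)
  also have "\<dots> = (\<Sum>j\<in>{k, l}. col_det n (V(j := c)) * G (V j))"
  proof (rule sum.mono_neutral_right)
    show "\<forall>j\<in>{..<n} - {k, l}. col_det n (V(j := c)) * G (V j) = 0"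
    proof
      fix j assume "j \<in> {..<n} - {k, l}"
      then have "G (V j) = 0"
        unfolding G using assms by (intro col_det_repeat[of k n j]) auto
      then show "col_det n (V(j := c)) * G (V j) = 0" by simp
    qed
  qed (use assms in auto)
  finally have "col_det n V * G c = (\<Sum>j\<in>{k, l}. col_det n (V(j := c)) * G (V j))" .
  moreover have "G (V k) = col_det n (V(l := d))"
    by (simp add: G)
  moreover have "G (V l) = - col_det n (V(k := d))"
  proof -
    have "col_det n (V(k := d, l := V l)) = col_det n (V(k := d))"
      using assms by (intro col_det_cong) auto
    then show ?thesis
      unfolding G by (subst col_det_swap) (use assms in auto)
  qed
  ultimately show ?thesis
    using assms by (simp add: G)
qed

lemma col_det_transpose: "col_det n V = col_det n (\<lambda>j i. V i j)"
proof -
  have "det (mat n n (\<lambda>(i, j). V j i)) = det (transpose_mat (mat n n (\<lambda>(i, j). V j i)))"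
    by (rule det_transpose[symmetric]) auto
  also have "transpose_mat (mat n n (\<lambda>(i, j). V j i)) = mat n n (\<lambda>(i, j). V i j)"
    by (rule eq_matI) auto
  finally show ?thesis by (simp add: col_det_def)
qed

lemma col_det_linear:
  assumes "k < n"
  shows "col_det n (V(k := (\<lambda>i. x i + a * y i))) = col_det n (V(k := x)) + a * col_det n (V(k := y))"
  by (simp only: col_det_laplace[OF assms]) (simp add: sum.distrib sum_distrib_left algebra_simps)

text \<open>In the Leibniz expansion the signs are constants, so the product rule applies to each
  summand; exchanging the sums over permutations and columns regroups the result into
  determinants.\<close>

lemma pderiv_col_det:
  fixes V :: "nat \<Rightarrow> nat \<Rightarrow> 'a :: idom poly"
  shows "pderiv (col_det n V) = (\<Sum>k<n. col_det n (V(k := (\<lambda>i. pderiv (V k i)))))"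
proof -
  have leibniz: "col_det n W = (\<Sum>p | p permutes {0..<n}. signof p * (\<Prod>j<n. W j (p j)))"
    for W :: "nat \<Rightarrow> nat \<Rightarrow> 'a poly"
  proof -
    have "col_det n W = det (mat n n (\<lambda>(i, j). W i j))"
      by (subst col_det_transpose) (simp add: col_det_def)
    also have "\<dots> = (\<Sum>p | p permutes {0..<n}. signof p * (\<Prod>j = 0..<n. mat n n (\<lambda>(i, j). W i j) $$ (j, p j)))"
      by (rule det_def') simp
    also have "\<dots> = (\<Sum>p | p permutes {0..<n}. signof p * (\<Prod>j<n. W j (p j)))"
      by (intro sum.cong refl arg_cong2[of _ _ _ _ "(*)"] prod.cong)
        (use permutes_in_image[of _ "{0..<n}"] in auto)
    finally show ?thesis .
  qed
  have sgn: "pderiv (signof p * x) = signof p * pderiv x" for p :: "nat \<Rightarrow> nat" and x :: "'a poly"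
    by (auto simp: sign_def pderiv_minus)
  have "pderiv (\<Prod>j<n. V j (p j)) =
      (\<Sum>k<n. \<Prod>j<n. (V(k := (\<lambda>i. pderiv (V k i)))) j (p j))" for p
  proof -
    have "(\<Prod>j<n. (V(k := (\<lambda>i. pderiv (V k i)))) j (p j)) =
        (\<Prod>j\<in>{..<n} - {k}. V j (p j)) * pderiv (V k (p k))" if "k < n" for k
      using that by (subst prod.remove[of _ k]) (auto simp: mult.commute intro!: prod.cong)
    then show ?thesis by (simp add: pderiv_prod)
  qed
  then have "pderiv (col_det n V) = (\<Sum>p | p permutes {0..<n}. \<Sum>k<n.
      signof p * (\<Prod>j<n. (V(k := (\<lambda>i. pderiv (V k i)))) j (p j)))"
    by (simp only: leibniz higher_pderiv_sum[of 1, simplified] sgn sum_distrib_left)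
  then show ?thesis
    by (subst (asm) sum.swap) (simp only: leibniz)
qed

subsection \<open>Hankel determinants\<close>

definition hankel :: "(nat \<Rightarrow> 'a :: comm_ring_1) \<Rightarrow> nat \<Rightarrow> 'a" where
  "hankel c n = col_det n (\<lambda>j i. c (i + j))"

text \<open>The Hankel determinant of size \<open>n + 1\<close> whose last column is moved one step
  ahead. It is what remains of the derivative of \<open>hankel c (Suc n)\<close> when
  differentiation shifts the sequence.\<close>

definition hankel_bump :: "(nat \<Rightarrow> 'a :: comm_ring_1) \<Rightarrow> nat \<Rightarrow> 'a" where
  "hankel_bump c n = col_det (Suc n) ((\<lambda>j i. c (i + j))(n := (\<lambda>i. c (i + Suc n))))"

lemma hankel_0 [simp]: "hankel c 0 = 1"
  by (simp add: hankel_def)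

lemma col_det_1: "col_det (Suc 0) V = V 0 0"
  using col_det_laplace[of 0 "Suc 0" V "V 0"]
  by (simp add: cofactor_def mat_delete_def det_dim_zero fun_upd_idem)

lemma hankel_1: "hankel c (Suc 0) = c 0"
  by (simp add: hankel_def col_det_1)

text \<open>Jacobi's identity for the Hankel matrix of size \<open>n + 2\<close>, with columns
  \<open>n\<close> and \<open>n + 1\<close> replaced by the first and last unit vectors. Deleting
  row \<open>0\<close> shifts the sequence, and deleting column \<open>n\<close> produces the
  bump.\<close>

lemma hankel_jacobi:
  "hankel c (Suc (Suc n)) * hankel (c \<circ> Suc) n =
    hankel_bump (c \<circ> Suc) n * hankel c (Suc n) - hankel_bump c n * hankel (c \<circ> Suc) (Suc n)"
proof -
  let ?V = "\<lambda>j i. c (i + j)"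
  have 1: "col_det (Suc (Suc n)) (?V(n := unit_col 0, Suc n := unit_col (Suc n))) =
      (-1) ^ n * hankel (c \<circ> Suc) n"
  proof -
    have "col_det (Suc (Suc n)) (?V(n := unit_col 0, Suc n := unit_col (Suc n))) =
        col_det (Suc n) (?V(n := unit_col 0))"
      by (subst col_det_unit) (auto intro!: col_det_cong)
    also have "\<dots> = (-1) ^ n * hankel (c \<circ> Suc) n"
      by (subst col_det_unit)
        (auto simp: hankel_def intro!: arg_cong2[of _ _ _ _ "(*)"] col_det_cong)
    finally show ?thesis .
  qed
  have 2: "col_det (Suc (Suc n)) (?V(n := unit_col 0)) = (-1) ^ n * hankel_bump (c \<circ> Suc) n"
    by (subst col_det_unit)
      (auto simp: hankel_bump_def insert_index_def intro!: arg_cong2[of _ _ _ _ "(*)"] col_det_cong)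
  have 3: "col_det (Suc (Suc n)) (?V(Suc n := unit_col (Suc n))) = hankel c (Suc n)"
    by (subst col_det_unit) (auto simp: hankel_def intro!: col_det_cong)
  have 4: "col_det (Suc (Suc n)) (?V(n := unit_col (Suc n))) = - hankel_bump c n"
    by (subst col_det_unit)
      (auto simp: hankel_bump_def insert_index_def intro!: col_det_cong)
  have 5: "col_det (Suc (Suc n)) (?V(Suc n := unit_col 0)) = - ((-1) ^ n * hankel (c \<circ> Suc) (Suc n))"
    by (subst col_det_unit)
      (auto simp: hankel_def intro!: arg_cong2[of _ _ _ _ "(*)"] col_det_cong)
  \<comment> \<open>The minors carry signs \<open>(-1) ^ n\<close>. In a general ring they are
    removed by multiplying with \<open>s\<close> twice, as \<open>s * s = 1\<close>.\<close>
  define s :: 'a where "s = (-1) ^ n"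
  have s: "s * s = 1"
    by (simp add: s_def flip: power_mult_distrib)
  have "s * (s * (hankel c (Suc (Suc n)) * hankel (c \<circ> Suc) n)) =
      s * (s * (hankel_bump (c \<circ> Suc) n * hankel c (Suc n)
        - hankel_bump c n * hankel (c \<circ> Suc) (Suc n)))"
    using arg_cong[OF col_det_jacobi[of n "Suc (Suc n)" "Suc n" ?V "unit_col 0" "unit_col (Suc n)"],
        of "\<lambda>x. s * x"]
    unfolding 1 2 3 4 5 s_def[symmetric] by (simp add: hankel_def algebra_simps)
  then show ?thesis
    unfolding mult.assoc[of s s, symmetric] s by simp
qed

text \<open>Bordering the Hankel matrix by the row \<open>e\<^sub>0\<close> turns both the shifted and the unshifted
  determinants into minors of a single matrix, so that Jacobi's identity applies again.\<close>

lemma hankel_plucker: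
  "hankel c (Suc (Suc n)) * hankel_bump (c \<circ> Suc) n =
    hankel (c \<circ> Suc) (Suc n) * hankel_bump c (Suc n) - hankel (c \<circ> Suc) (Suc (Suc n)) * hankel c (Suc n)"
proof -
  define V :: "nat \<Rightarrow> nat \<Rightarrow> 'a" where
    "V = (\<lambda>j i. if i = Suc (Suc n) then unit_col 0 j else c (i + j))"
  let ?N = "Suc (Suc (Suc n))"
  \<comment> \<open>Expansion along a last row equal to the first unit vector deletes column
    \<open>0\<close>, which again shifts the sequence by one.\<close>
  have row: "col_det (Suc k) (\<lambda>j i. if i = k then unit_col 0 j else W j i) =
      (-1) ^ k * col_det k (\<lambda>j. W (Suc j))" for k and W :: "nat \<Rightarrow> nat \<Rightarrow> 'a"
  proof -
    have "col_det (Suc k) (\<lambda>j i. if i = k then unit_col 0 j else W j i) =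
        col_det (Suc k) ((\<lambda>j i. W i j)(k := unit_col 0))"
      by (subst col_det_transpose) (auto intro!: col_det_cong)
    also have "\<dots> = (-1) ^ k * col_det k (\<lambda>j i. W (Suc i) j)"
      by (subst col_det_unit) (auto intro!: arg_cong2[of _ _ _ _ "(*)"] col_det_cong)
    finally show ?thesis by (simp add: col_det_transpose[of k "\<lambda>j. W (Suc j)"])
  qed
  have 0: "col_det ?N V = - ((-1) ^ Suc n * hankel (c \<circ> Suc) (Suc (Suc n)))"
    unfolding V_def row by (simp add: hankel_def)
  have 1: "col_det ?N (V(Suc n := unit_col (Suc n), Suc (Suc n) := unit_col (Suc (Suc n)))) =
      hankel c (Suc n)"
  proof -
    have "col_det ?N (V(Suc n := unit_col (Suc n), Suc (Suc n) := unit_col (Suc (Suc n)))) =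
        col_det (Suc (Suc n)) ((\<lambda>j i. c (i + j))(Suc n := unit_col (Suc n)))"
      by (subst col_det_unit) (auto simp: V_def intro!: col_det_cong)
    also have "\<dots> = hankel c (Suc n)"
      by (subst col_det_unit) (auto simp: hankel_def intro!: col_det_cong)
    finally show ?thesis .
  qed
  have 2: "col_det ?N (V(Suc n := unit_col (Suc n))) = (-1) ^ Suc n * hankel_bump (c \<circ> Suc) n"
  proof -
    have "col_det ?N (V(Suc n := unit_col (Suc n))) = col_det (Suc (Suc n))
        (\<lambda>j i. if i = Suc n then unit_col 0 j
          else ((\<lambda>j i. c (i + j))(Suc n := (\<lambda>i. c (i + Suc (Suc n))))) j i)"
      by (subst col_det_unit)
        (auto simp: V_def insert_index_def unit_col_def intro!: col_det_cong)
    also have "\<dots> = (-1) ^ Suc n * hankel_bump (c \<circ> Suc) n"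
      unfolding row hankel_bump_def by (auto intro!: arg_cong2[of _ _ _ _ "(*)"] col_det_cong)
    finally show ?thesis .
  qed
  have 3: "col_det ?N (V(Suc (Suc n) := unit_col (Suc (Suc n)))) = hankel c (Suc (Suc n))"
    by (subst col_det_unit) (auto simp: hankel_def V_def intro!: col_det_cong)
  have 4: "col_det ?N (V(Suc (Suc n) := unit_col (Suc n))) =
      - ((-1) ^ Suc n * hankel (c \<circ> Suc) (Suc n))"
  proof -
    have "col_det ?N (V(Suc (Suc n) := unit_col (Suc n))) = - col_det (Suc (Suc n))
        (\<lambda>j i. if i = Suc n then unit_col 0 j else c (i + j))"
      by (subst col_det_unit)
        (auto simp: V_def insert_index_def intro!: col_det_cong)
    also have "\<dots> = - ((-1) ^ Suc n * hankel (c \<circ> Suc) (Suc n))"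
      unfolding row by (simp add: hankel_def)
    finally show ?thesis .
  qed
  have 5: "col_det ?N (V(Suc n := unit_col (Suc (Suc n)))) = - hankel_bump c (Suc n)"
    by (subst col_det_unit)
      (auto simp: hankel_bump_def V_def insert_index_def intro!: col_det_cong)
  define s :: 'a where "s = (-1) ^ Suc n"
  have s: "s * s = 1"
    by (simp add: s_def flip: power_mult_distrib)
  have "s * (s * (hankel (c \<circ> Suc) (Suc (Suc n)) * hankel c (Suc n))) =
      s * (s * (hankel (c \<circ> Suc) (Suc n) * hankel_bump c (Suc n)
        - hankel c (Suc (Suc n)) * hankel_bump (c \<circ> Suc) n))"
    using col_det_jacobi[of "Suc n" ?N "Suc (Suc n)" V "unit_col (Suc n)" "unit_col (Suc (Suc n))"]
    unfolding 0 1 2 3 4 5 s_def[symmetric] by (simp add: algebra_simps)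
  then have "hankel (c \<circ> Suc) (Suc (Suc n)) * hankel c (Suc n) =
      hankel (c \<circ> Suc) (Suc n) * hankel_bump c (Suc n)
        - hankel c (Suc (Suc n)) * hankel_bump (c \<circ> Suc) n"
    unfolding mult.assoc[of s s, symmetric] s by simp
  then show ?thesis
    by (simp add: algebra_simps)
qed

section \<open>Derivatives of Hankel determinants and bilinear relations of Toda type\<close>

text \<open>Differentiating column \<open>k\<close> gives column \<open>k + 1\<close> plus
  \<open>l\<close> times column \<open>k\<close>. The first part repeats a column unless
  \<open>k\<close> is last, and the second contributes one copy of the determinant per
  column.\<close>

lemma pderiv_hankel:
  fixes c :: "nat \<Rightarrow> 'a :: idom poly"
  assumes "\<And>j. pderiv (c j) = c (Suc j) + smult l (c j)"
  shows "pderiv (hankel c (Suc n)) = hankel_bump c n + of_nat (Suc n) * smult l (hankel c (Suc n))"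
proof -
  let ?V = "\<lambda>j i. c (i + j)"
  have col: "col_det (Suc n) (?V(k := (\<lambda>i. pderiv (c (i + k))))) =
      (if k = n then hankel_bump c n else 0) + smult l (hankel c (Suc n))" if "k < Suc n" for k
  proof -
    have "col_det (Suc n) (?V(k := (\<lambda>i. pderiv (c (i + k))))) =
        col_det (Suc n) (?V(k := (\<lambda>i. c (i + Suc k) + [:l:] * c (i + k))))"
      by (simp add: assms)
    also have "\<dots> = col_det (Suc n) (?V(k := (\<lambda>i. c (i + Suc k)))) + [:l:] * col_det (Suc n) (?V(k := ?V k))"
      using that by (rule col_det_linear)
    also have "col_det (Suc n) (?V(k := ?V k)) = hankel c (Suc n)"
      by (auto simp: hankel_def intro!: col_det_cong)
    also have "col_det (Suc n) (?V(k := (\<lambda>i. c (i + Suc k)))) = (if k = n then hankel_bump c n else 0)"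
    proof (cases "k = n")
      case True
      then show ?thesis by (simp add: hankel_bump_def)
    next
      case False
      with that have "col_det (Suc n) (?V(k := (\<lambda>i. c (i + Suc k)))) = 0"
        by (intro col_det_repeat[of k _ "Suc k"]) auto
      with False show ?thesis by simp
    qed
    also have "[:l:] * hankel c (Suc n) = smult l (hankel c (Suc n))"
      by simp
    finally show ?thesis .
  qed
  have "pderiv (hankel c (Suc n)) =
      (\<Sum>k<Suc n. col_det (Suc n) (?V(k := (\<lambda>i. pderiv (c (i + k))))))"
    unfolding hankel_def by (rule pderiv_col_det)
  also have "\<dots> = (\<Sum>k<Suc n. (if k = n then hankel_bump c n else 0) + smult l (hankel c (Suc n)))"
    by (intro sum.cong refl col) simp
  finally show ?thesis
    by (simp add: sum.distrib del: sum.lessThan_Suc)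
qed

text \<open>This is \<open>hankel_jacobi\<close> with the bumps expressed by derivatives. Both
  determinants have size \<open>n + 1\<close>, so their \<open>l\<close> terms cancel.\<close>

lemma hankel_toda_even:
  fixes c :: "nat \<Rightarrow> 'a :: idom poly"
  assumes "\<And>j. pderiv (c j) = c (Suc j) + smult l (c j)"
  shows "hankel c (Suc (Suc n)) * hankel (c \<circ> Suc) n =
    hankel c (Suc n) * pderiv (hankel (c \<circ> Suc) (Suc n))
    - pderiv (hankel c (Suc n)) * hankel (c \<circ> Suc) (Suc n)"
proof -
  have "pderiv (hankel (c \<circ> Suc) (Suc n)) =
      hankel_bump (c \<circ> Suc) n + of_nat (Suc n) * smult l (hankel (c \<circ> Suc) (Suc n))"
    by (rule pderiv_hankel) (simp add: assms)
  then show ?thesis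
    by (simp add: hankel_jacobi pderiv_hankel[of c l, OF assms] algebra_simps)
qed

text \<open>This is \<open>hankel_plucker\<close> with the bumps expressed by derivatives. The sizes
  are \<open>n + 1\<close> and \<open>n\<close>, so exactly one \<open>l\<close> term
  survives.\<close>

lemma hankel_toda_odd:
  fixes c :: "nat \<Rightarrow> 'a :: idom poly"
  assumes "\<And>j. pderiv (c j) = c (Suc j) + smult l (c j)"
  shows "hankel (c \<circ> Suc) (Suc n) * hankel c n =
    pderiv (hankel c (Suc n)) * hankel (c \<circ> Suc) n
    - hankel c (Suc n) * pderiv (hankel (c \<circ> Suc) n)
    - smult l (hankel c (Suc n) * hankel (c \<circ> Suc) n)"
proof (cases n)
  case 0
  then show ?thesis by (simp add: hankel_1 assms)
next
  case (Suc k)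
  have "pderiv (hankel (c \<circ> Suc) (Suc k)) =
      hankel_bump (c \<circ> Suc) k + of_nat (Suc k) * smult l (hankel (c \<circ> Suc) (Suc k))"
    by (rule pderiv_hankel) (simp add: assms)
  moreover have "hankel (c \<circ> Suc) (Suc (Suc k)) * hankel c (Suc k) =
      hankel (c \<circ> Suc) (Suc k) * hankel_bump c (Suc k)
      - hankel c (Suc (Suc k)) * hankel_bump (c \<circ> Suc) k"
    by (simp add: hankel_plucker)
  moreover define K where "K = [:l:]"
  have "smult l x = K * x" for x
    by (simp add: K_def)
  ultimately show ?thesis
    by (simp add: Suc pderiv_hankel[of c l, OF assms] algebra_simps)
qed

section \<open>Degrees of the Hankel determinants of derivatives\<close>

text \<open>The coefficient in degree \<open>degree p + degree q - 1\<close> is the difference of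
  the degrees times both leading coefficients, hence nonzero in characteristic 0.\<close>

lemma wronskian_degree:
  fixes p q :: "'a :: {idom, ring_char_0} poly"
  assumes "p \<noteq> 0" "q \<noteq> 0" "degree p \<noteq> degree q"
  shows "pderiv p * q - p * pderiv q \<noteq> 0"
    "Suc (degree (pderiv p * q - p * pderiv q)) = degree p + degree q"
proof -
  let ?W = "pderiv p * q - p * pderiv q"
  obtain e where e: "degree p + degree q = Suc e"
    using assms(3) by (cases "degree p + degree q") auto
  have top: "coeff (pderiv f * g) e = of_nat (degree f) * (lead_coeff f * lead_coeff g)"
    and le: "degree (pderiv f * g) \<le> e"
    if "degree f + degree g = Suc e" for f g :: "'a poly"
  proof -
    show "coeff (pderiv f * g) e = of_nat (degree f) * (lead_coeff f * lead_coeff g)"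
    proof (cases "degree f")
      case 0
      then show ?thesis by (simp add: pderiv_eq_0_iff[THEN iffD2])
    next
      case (Suc k)
      then have "e = degree (pderiv f) + degree g"
        using that by (simp add: degree_pderiv)
      then have "coeff (pderiv f * g) e = lead_coeff (pderiv f) * lead_coeff g"
        by (simp only: coeff_mult_degree_sum)
      then show ?thesis
        using Suc by (simp add: coeff_pderiv degree_pderiv)
    qed
    show "degree (pderiv f * g) \<le> e"
    proof (cases "degree f")
      case 0
      then show ?thesis by (simp add: pderiv_eq_0_iff[THEN iffD2])
    next
      case (Suc k)
      then show ?thesis
        using degree_mult_le[of "pderiv f" g] that by (simp add: degree_pderiv)
    qed
  qed
  have "coeff ?W e = (of_nat (degree p) - of_nat (degree q)) * (lead_coeff p * lead_coeff q)"
    using top[of p q] top[of q p] e by (simp add: algebra_simps)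
  then have c: "coeff ?W e \<noteq> 0"
    using assms by simp
  then show "?W \<noteq> 0" by auto
  have "degree ?W \<le> e"
    using le[of p q] le[of q p] e by (intro degree_diff_le) (auto simp: algebra_simps)
  with le_degree[OF c] e show "Suc (degree ?W) = degree p + degree q" by simp
qed

text \<open>No determinant is evaluated: the bilinear relations give the degrees recursively, because the
  Wronskian of polynomials of different degrees has degree one less than the product.\<close>

lemma hankel_degree_aux:
  fixes f :: "'a :: {idom, ring_char_0} poly"
  assumes "f \<noteq> 0" "n \<le> degree f"
  defines "T \<equiv> hankel (\<lambda>j. (pderiv ^^ j) f)"
    and "S \<equiv> hankel ((\<lambda>j. (pderiv ^^ j) f) \<circ> Suc)"
  shows "T n \<noteq> 0 \<and> degree (T n) = n * (Suc (degree f) - n) \<and>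
    S n \<noteq> 0 \<and> degree (S n) = n * (degree f - n) \<and>
    T (Suc n) \<noteq> 0 \<and> degree (T (Suc n)) = Suc n * (degree f - n)"
  using assms(2)
proof (induction n)
  case 0
  then show ?case using assms(1) by (simp add: hankel_1 T_def S_def)
next
  case (Suc n)
  obtain r where r: "degree f = Suc (n + r)"
    using Suc.prems by (metis add_Suc less_eqE)
  have deriv: "pderiv ((pderiv ^^ j) f) = (pderiv ^^ Suc j) f + smult 0 ((pderiv ^^ j) f)" for j
    by simp
  have IH: "T n \<noteq> 0" "degree (T n) = n * Suc (Suc r)" "S n \<noteq> 0" "degree (S n) = n * Suc r"
    "T (Suc n) \<noteq> 0" "degree (T (Suc n)) = Suc n * Suc r"
    using Suc by (simp_all add: r Suc_diff_le)
  let ?W = "pderiv (T (Suc n)) * S n - T (Suc n) * pderiv (S n)"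
  have odd: "S (Suc n) * T n = ?W"
    unfolding S_def T_def using hankel_toda_odd[of "\<lambda>j. (pderiv ^^ j) f" 0, OF deriv, of n] by simp
  \<comment> \<open>The degrees are \<open>(n + 1) * (r + 1)\<close> and \<open>n * (r + 1)\<close>,
    hence different. For the second Wronskian below they are \<open>(n + 1) * r\<close> and
    \<open>(n + 1) * (r + 1)\<close>.\<close>
  have W: "?W \<noteq> 0" "Suc (degree ?W) = degree (T (Suc n)) + degree (S n)"
    using wronskian_degree[OF IH(5,3)] IH by simp_all
  have S: "S (Suc n) \<noteq> 0"
    using odd W(1) by auto
  have dS: "degree (S (Suc n)) = Suc n * r"
    using W(2) IH S unfolding odd[symmetric] by (simp add: degree_mult_eq)
  let ?W = "pderiv (S (Suc n)) * T (Suc n) - S (Suc n) * pderiv (T (Suc n))"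
  have even: "T (Suc (Suc n)) * S n = ?W"
    unfolding S_def T_def using hankel_toda_even[of "\<lambda>j. (pderiv ^^ j) f" 0, OF deriv, of n] by (simp add: mult.commute)
  have W: "?W \<noteq> 0" "Suc (degree ?W) = degree (S (Suc n)) + degree (T (Suc n))"
    using wronskian_degree[OF S IH(5)] dS IH by simp_all
  have T: "T (Suc (Suc n)) \<noteq> 0"
    using even W(1) by auto
  have dT: "degree (T (Suc (Suc n))) = Suc (Suc n) * r"
    using W(2) IH T dS unfolding even[symmetric] by (simp add: degree_mult_eq)
  show ?case
    using S dS T dT IH by (simp add: r)
qed

lemma hankel_pderiv_degree:
  fixes f :: "'a :: {idom, ring_char_0} poly"
  assumes "f \<noteq> 0" "n \<le> Suc (degree f)"
  shows "hankel (\<lambda>j. (pderiv ^^ j) f) n \<noteq> 0"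
    "degree (hankel (\<lambda>j. (pderiv ^^ j) f) n) = n * (Suc (degree f) - n)"
  using hankel_degree_aux[OF assms(1), of n] hankel_degree_aux[OF assms(1), of "n - 1"] assms(2)
  by (cases "n = Suc (degree f)"; simp)+

subsection \<open>Derivations with a constant shift\<close>

definition shift_deriv :: "'a :: idom \<Rightarrow> 'a poly \<Rightarrow> 'a poly" where
  "shift_deriv l p = pderiv p - smult l p"

text \<open>The coefficient of \<open>X ^ k\<close> in \<open>(X - l) ^ i\<close>, that is, of the
  \<open>k\<close>-th derivative in the \<open>i\<close>-th power of
  \<open>shift_deriv l\<close>.\<close>

primrec shift_coeff :: "'a :: idom \<Rightarrow> nat \<Rightarrow> nat \<Rightarrow> 'a" where
  "shift_coeff l 0 k = (if k = 0 then 1 else 0)"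
| "shift_coeff l (Suc i) k = (case k of 0 \<Rightarrow> 0 | Suc k' \<Rightarrow> shift_coeff l i k') - l * shift_coeff l i k"

lemma shift_coeff_triangular:
  "i < k \<Longrightarrow> shift_coeff l i k = 0" "shift_coeff l i i = 1"
proof -
  show *: "i < k \<Longrightarrow> shift_coeff l i k = 0" for i k
    by (induction i arbitrary: k) (auto split: nat.split)
  show "shift_coeff l i i = 1"
    by (induction i) (auto simp: *)
qed

text \<open>Coefficients beyond \<open>i\<close> vanish, so the sum may run up to any
  \<open>n > i\<close>. One bound \<open>n\<close> then serves all rows of an \<open>n\<close> by
  \<open>n\<close> matrix.\<close>

lemma shift_deriv_power:
  assumes "i < n"
  shows "(shift_deriv l ^^ i) h = (\<Sum>k<n. smult (shift_coeff l i k) ((pderiv ^^ k) h))"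
  using assms
proof (induction i arbitrary: n)
  case 0
  then have "(\<Sum>k<n. smult (shift_coeff l 0 k) ((pderiv ^^ k) h)) =
      (\<Sum>k<n. if k = 0 then h else 0)"
    by (intro sum.cong) auto
  with 0 show ?case by simp
next
  case (Suc i)
  then obtain n' where n: "n = Suc n'" "i < n'"
    by (cases n) auto
  have "(shift_deriv l ^^ Suc i) h = pderiv ((shift_deriv l ^^ i) h) - smult l ((shift_deriv l ^^ i) h)"
    by (simp add: shift_deriv_def)
  also have "pderiv ((shift_deriv l ^^ i) h) = (\<Sum>k<n'. smult (shift_coeff l i k) ((pderiv ^^ Suc k) h))"
    by (simp add: Suc.IH[OF n(2)] higher_pderiv_sum[of 1, simplified] pderiv_smult)
  also have "\<dots> = (\<Sum>k<n. smult (case k of 0 \<Rightarrow> 0 | Suc k' \<Rightarrow> shift_coeff l i k') ((pderiv ^^ k) h))"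
    unfolding n by (subst sum.lessThan_Suc_shift) simp
  also have "smult l ((shift_deriv l ^^ i) h) = (\<Sum>k<n. smult (l * shift_coeff l i k) ((pderiv ^^ k) h))"
  proof -
    have "smult l (sum f A) = (\<Sum>x\<in>A. smult l (f x))" for f :: "nat \<Rightarrow> 'a poly" and A
      by (induction A rule: infinite_finite_induct) (auto simp: smult_add_right)
    then show ?thesis
      using n by (subst Suc.IH[of n]) (simp_all del: sum.lessThan_Suc)
  qed
  finally show ?case
    by (simp add: smult_diff_left sum_subtractf)
qed

text \<open>Powers of \<open>D - l\<close> are unitriangular combinations of powers of
  \<open>D\<close>. The two Hankel matrices are therefore congruent through a matrix
  \<open>P\<close> of determinant 1.\<close>

lemma hankel_shift_deriv:
  "hankel (\<lambda>j. (shift_deriv l ^^ j) h) n = hankel (\<lambda>j. (pderiv ^^ j) h) n"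
proof -
  let ?P = "mat n n (\<lambda>(i, k). [:shift_coeff l i k:])"
  let ?M = "mat n n (\<lambda>(i, j). (pderiv ^^ (i + j)) h)"
  let ?Q = "mat n n (\<lambda>(i, j). (shift_deriv l ^^ (i + j)) h)"
  have det_P: "det ?P = 1"
    by (subst det_lower_triangular[of n])
      (auto simp: shift_coeff_triangular prod_list_diag_prod simp flip: one_pCons)
  have "?Q = ?P * (?M * transpose_mat ?P)"
  proof (rule eq_matI)
    fix i j assume "i < dim_row (?P * (?M * transpose_mat ?P))" "j < dim_col (?P * (?M * transpose_mat ?P))"
    then have ij: "i < n" "j < n" by auto
    have "(shift_deriv l ^^ (i + j)) h = (shift_deriv l ^^ i) ((shift_deriv l ^^ j) h)"
      by (simp add: funpow_add)
    also have "\<dots> = (\<Sum>k<n. smult (shift_coeff l i k)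
        ((pderiv ^^ k) (\<Sum>m<n. smult (shift_coeff l j m) ((pderiv ^^ m) h))))"
      by (simp only: shift_deriv_power[OF ij(1)] shift_deriv_power[OF ij(2)])
    also have "\<dots> = (\<Sum>k<n. [:shift_coeff l i k:] *
        (\<Sum>m<n. (pderiv ^^ (k + m)) h * [:shift_coeff l j m:]))"
      by (simp add: higher_pderiv_sum higher_pderiv_smult funpow_add)
    also have "\<dots> = (?P * (?M * transpose_mat ?P)) $$ (i, j)"
      using ij by (simp add: scalar_prod_def atLeast0LessThan)
    finally show "?Q $$ (i, j) = (?P * (?M * transpose_mat ?P)) $$ (i, j)"
      using ij by simp
  qed auto
  then have "det ?Q = det (?P * (?M * transpose_mat ?P))"
    by simp
  also have "\<dots> = det ?P * det (?M * transpose_mat ?P)"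
    by (rule det_mult[of _ n]) auto
  also have "det (?M * transpose_mat ?P) = det ?M * det (transpose_mat ?P)"
    by (rule det_mult[of _ n]) auto
  also have "det (transpose_mat ?P) = det ?P"
    by (rule det_transpose[of _ n]) auto
  finally show ?thesis by (simp add: det_P hankel_def col_det_def)
qed

subsection \<open>The first-order system behind the fifth Painleve equation\<close>

text \<open>The first equation is differentiated once more, the second supplies the derivative of
  \<open>B\<close>, and \<open>B\<close> is eliminated through the first.\<close>

lemma PV_from_system:
  fixes w B :: "complex \<Rightarrow> complex" and m k n a :: complex
  assumes U: "open U" "z \<in> U"
    and nz: "\<And>z. z \<in> U \<Longrightarrow> z \<noteq> 0 \<and> w z \<noteq> 0 \<and> w z \<noteq> 1"
    and dw: "\<And>z. z \<in> U \<Longrightarrow> (w has_field_derivative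
      w z * ((w z - 1) * (2 * B z - m + k / w z) - z) / z) (at z)"
    and dB: "\<And>z. z \<in> U \<Longrightarrow> (B has_field_derivative
      ((w z - 1) * B z * (m - B z) - z * (B z + n) / (w z - 1)) / z) (at z)"
    and k: "k = m + 2 * n + a"
  shows "PV_equation_at (1/2 * m\<^sup>2) (- 1/2 * k\<^sup>2) (a - 1) w z"
proof -
  \<comment> \<open>In the application \<open>X\<close> is \<open>B - A\<close>, with
    \<open>A\<close> removed by \<open>A + B = m - k / w\<close>. The constants \<open>dB'\<close>
    and \<open>dX\<close> below are \<open>z\<close> times the derivatives of \<open>B\<close> and
    \<open>X\<close>.\<close>
  define X where "X = (\<lambda>z. 2 * B z - m + k / w z)"
  define dB' where "dB' = (w z - 1) * B z * (m - B z) - z * (B z + n) / (w z - 1)"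
  define dX where "dX = 2 * dB' - k / w z * ((w z - 1) * X z - z)"
  define W where "W = (\<lambda>z. w z * ((w z - 1) * X z - z) / z)"
  have nz': "z \<noteq> 0" "w z \<noteq> 0" "w z - 1 \<noteq> 0"
    using nz[OF U(2)] by auto
  define y where "y = w z - 1"
  have w: "w z = y + 1" and y: "y \<noteq> 0" "y + 1 \<noteq> 0" using nz' by (auto simp: y_def)
  have y2: "2 * y + 2 \<noteq> 0"
    using y(2) by (metis distrib_left mult_1_right mult_eq_0_iff zero_neq_numeral)
  have dw': "(w has_field_derivative W z) (at z)"
    using dw[OF U(2)] by (simp add: W_def X_def)
  have "(B has_field_derivative dB' / z) (at z)"
    unfolding dB'_def by (rule dB[OF U(2)])
  then have "(X has_field_derivative 2 * (dB' / z) - k * W z / (w z * w z)) (at z)"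
    unfolding X_def using nz' by (auto intro!: derivative_eq_intros dw')
  moreover have "k * W z / (w z * w z) = k / w z * ((w z - 1) * X z - z) / z"
    using nz' by (simp add: W_def field_simps)
  ultimately have dX': "(X has_field_derivative dX / z) (at z)"
    by (simp add: dX_def diff_divide_distrib)
  have "((\<lambda>z. w z * ((w z - 1) * X z - z)) has_field_derivative
      W z * ((w z - 1) * X z - z) + w z * (W z * X z + (w z - 1) * (dX / z) - 1)) (at z)"
    by (auto intro!: derivative_eq_intros dw' dX' simp: algebra_simps)
  from DERIV_divide[OF this DERIV_ident nz'(1)]
  have "(W has_field_derivative ((W z * ((w z - 1) * X z - z) +
      w z * (W z * X z + (w z - 1) * (dX / z) - 1)) * z - w z * ((w z - 1) * X z - z)) / (z * z)) (at z)"
    by (simp only: W_def mult_1_right)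
  moreover have "deriv w y = W y" if "y \<in> U" for y
    using dw[OF that] by (auto simp: W_def X_def intro!: DERIV_imp_deriv)
  then have "deriv (deriv w) z = deriv W z"
    using U by (intro deriv_cong_ev refl) (auto simp: eventually_nhds)
  ultimately have ddw: "deriv (deriv w) z = ((W z * ((w z - 1) * X z - z) +
      w z * (W z * X z + (w z - 1) * (dX / z) - 1)) * z - w z * ((w z - 1) * X z - z)) / (z * z)"
    by (simp add: DERIV_imp_deriv)
  define \<kappa> where "\<kappa> = k / w z"
  have \<kappa>: "k = \<kappa> * w z" using nz' by (simp add: \<kappa>_def)
  have B: "B z = (X z + m - \<kappa>) / 2"
    by (simp add: X_def \<kappa>_def)
  have n: "n = (k - m - a) / 2" using k by simp
  \<comment> \<open>The factor \<open>w z - 1\<close> clears the denominator. After substituting for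
    \<open>B\<close>, \<open>n\<close> and \<open>k\<close>, the mixed term in
    \<open>\<kappa> * X z\<close> cancels and only squares remain.\<close>
  have "(w z - 1) * dX = 2 * (w z - 1)\<^sup>2 * B z * (m - B z) - 2 * z * (B z + n)
      - \<kappa> * (w z - 1) * ((w z - 1) * X z - z)"
    unfolding dX_def dB'_def \<kappa>_def[symmetric] unfolding w using y by (simp add: field_simps power2_eq_square)
  also have "\<dots> = (w z - 1)\<^sup>2 * (m\<^sup>2 - \<kappa>\<^sup>2 - (X z)\<^sup>2) / 2 - z * (X z - a)"
    unfolding B n \<kappa> by (simp add: field_simps power2_eq_square)
  finally have dX: "(w z - 1) * dX = (w z - 1)\<^sup>2 * (m\<^sup>2 - \<kappa>\<^sup>2 - (X z)\<^sup>2) / 2 - z * (X z - a)" .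
  \<comment> \<open>\<open>u\<close> is \<open>z\<close> times the logarithmic derivative of
    \<open>w\<close>, so both sides of the Painleve equation become rational expressions in
    \<open>w\<close>, \<open>X\<close>, \<open>z\<close> and the constants.\<close>
  define u where "u = (w z - 1) * X z - z"
  have Wu: "W z = w z * u / z" by (simp add: W_def u_def)
  have "deriv (deriv w) z * z\<^sup>2 = w z * u * u + w z * (w z * u * X z + (w z - 1) * dX - z) - w z * u"
    unfolding ddw Wu u_def[symmetric] using nz' by (simp add: field_simps power2_eq_square)
  also have "\<dots> = z\<^sup>2 * ((1 / (2 * w z) + 1 / (w z - 1)) * (w z * u / z)\<^sup>2 - 1 / z * (w z * u / z)
       + (w z - 1)\<^sup>2 * (1/2 * m\<^sup>2 * (w z)\<^sup>2 + - 1/2 * k\<^sup>2) / (z\<^sup>2 * w z)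
       + (a - 1) * w z / z - w z * (w z + 1) / (2 * (w z - 1)))"
    unfolding dX unfolding u_def \<kappa> w using nz'(1) y y2 by (simp add: divide_simps) Groebner_Basis.algebra
  finally show ?thesis
    unfolding PV_equation_at_def using DERIV_imp_deriv[OF dw'] nz' by (simp add: Wu)
qed

section \<open>Propagation of the two extra relations along the Toda chain\<close>

text \<open>In the induction step the algebraic relation gives \<open>A n\<close>, and
  differentiating it gives \<open>B (Suc n)\<close> in terms of \<open>A n\<close> and
  \<open>w n\<close>. Differentiating that in turn, and comparing with \<open>dB\<close>, yields
  both relations at \<open>Suc n\<close>.\<close>

lemma toda_chain:
  fixes w A B :: "nat \<Rightarrow> complex \<Rightarrow> complex" and a N :: complex
  assumes U: "open U"
    and nz: "\<And>n z. n \<le> M \<Longrightarrow> z \<in> U \<Longrightarrow> z \<noteq> 0 \<and> w n z \<noteq> 0 \<and> w n z \<noteq> 1 \<and> A n z \<noteq> 0"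
    and nzB: "\<And>n z. n < M \<Longrightarrow> z \<in> U \<Longrightarrow> B (Suc n) z \<noteq> 0"
    and dw: "\<And>n z. n \<le> M \<Longrightarrow> z \<in> U \<Longrightarrow>
      (w n has_field_derivative w n z * ((w n z - 1) * (B n z - A n z) - z) / z) (at z)"
    and dA: "\<And>n z. n < M \<Longrightarrow> z \<in> U \<Longrightarrow>
      (A n has_field_derivative A n z * (1 + B (Suc n) z * w (Suc n) z - B n z * w n z) / z) (at z)"
    and dB: "\<And>n z. n < M \<Longrightarrow> z \<in> U \<Longrightarrow>
      (B (Suc n) has_field_derivative
        B (Suc n) z * (1 + A (Suc n) z * w (Suc n) z - A n z * w n z) / z) (at z)"
    and step: "\<And>n z. n < M \<Longrightarrow> z \<in> U \<Longrightarrow>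
      B (Suc n) z * (w (Suc n) z - 1) = z + A n z * (w n z - 1)"
    and init: "\<And>z. B 0 z = 0" "\<And>z. z \<in> U \<Longrightarrow> A 0 z * w 0 z = N * w 0 z - (N + a)"
    and "n \<le> M"
  shows "\<forall>z\<in>U. (A n z + B n z) * w n z = (N - of_nat n) * w n z - (N + of_nat n + a) \<and>
    (B n has_field_derivative ((w n z - 1) * B n z * (N - of_nat n - B n z)
      - z * (B n z + of_nat n) / (w n z - 1)) / z) (at z)"
  using \<open>n \<le> M\<close>
proof (induction n)
  case 0
  have "B 0 = (\<lambda>_. 0)" using init(1) by auto
  then show ?case using init(2) by simp
next
  case (Suc n)
  define m where "m = N - of_nat n"
  define k where "k = N + of_nat n + a"
  define \<nu> :: complex where "\<nu> = of_nat n"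
  \<comment> \<open>With this \<open>p\<close>, the hypothesis \<open>step\<close> reads
    \<open>B (Suc n) z * (w (Suc n) z - 1) = z + p z\<close>.\<close>
  define p where "p = (\<lambda>z. A n z * (w n z - 1))"
  define e where "e = (\<lambda>z. \<nu> + a + A n z * w n z)"
  have k: "k = m + 2 * \<nu> + a" by (simp add: k_def m_def \<nu>_def)
  from Suc.prems have n: "n < M" "n \<le> M" by auto
  have IH: "(A n z + B n z) * w n z = m * w n z - k"
    "(B n has_field_derivative ((w n z - 1) * B n z * (m - B n z)
      - z * (B n z + \<nu>) / (w n z - 1)) / z) (at z)" if "z \<in> U" for z
    using Suc.IH[OF n(2)] that by (auto simp: m_def k_def \<nu>_def)
  have A_eq: "A n z = m - k / w n z - B n z" if "z \<in> U" for z
    using IH(1)[OF that] nz[OF n(2) that] by (simp add: field_simps)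
  \<comment> \<open>Two expressions for the derivative of \<open>A n\<close> are equated: the chain
    equation \<open>dA\<close>, and the derivative of \<open>A_eq\<close>, where the induction
    hypothesis enters.\<close>
  have dA': "A n z * (1 + B (Suc n) z * w (Suc n) z - B n z * w n z) =
      k / w n z * ((w n z - 1) * (B n z - A n z) - z)
      - ((w n z - 1) * B n z * (m - B n z) - z * (B n z + \<nu>) / (w n z - 1))" (is "?L = ?R")
    if z: "z \<in> U" for z
  proof -
    have nz': "w n z \<noteq> 0" "w n z - 1 \<noteq> 0" "z \<noteq> 0" using nz[OF n(2) z] by auto
    have "((\<lambda>z. m - k / w n z - B n z) has_field_derivative
        k * (w n z * ((w n z - 1) * (B n z - A n z) - z) / z) / (w n z * w n z)
        - ((w n z - 1) * B n z * (m - B n z) - z * (B n z + \<nu>) / (w n z - 1)) / z) (at z)"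
      using nz' by (auto intro!: derivative_eq_intros IH(2)[OF z] dw[OF n(2) z])
    moreover have "k * (w n z * ((w n z - 1) * (B n z - A n z) - z) / z) / (w n z * w n z) =
        k / w n z * ((w n z - 1) * (B n z - A n z) - z) / z"
      using nz' by simp
    ultimately have "((\<lambda>z. m - k / w n z - B n z) has_field_derivative ?R / z) (at z)"
      by (simp add: diff_divide_distrib)
    then have "(A n has_field_derivative ?R / z) (at z)"
      by (rule has_field_derivative_transform_within_open[OF _ U z]) (simp add: A_eq)
    with dA[OF n(1) z] have "?L / z = ?R / z"
      by (rule DERIV_unique)
    with nz' show ?thesis by simp
  qed
  \<comment> \<open>\<open>B n\<close> and \<open>w (Suc n)\<close> drop out, which leaves
    \<open>B (Suc n)\<close> determined by \<open>A n\<close> and \<open>w n\<close> alone.\<close>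
  have p_eq: "p z * B (Suc n) z = - (\<nu> + 1) * p z - (z + p z) * e z" if z: "z \<in> U" for z
  proof -
    have nz': "w n z \<noteq> 0" "w n z - 1 \<noteq> 0" "z \<noteq> 0" using nz[OF n(2) z] by auto
    define \<kappa> where "\<kappa> = k / w n z"
    have \<kappa>: "\<kappa> * w n z = m + 2 * \<nu> + a" using nz' k by (simp add: \<kappa>_def)
    have m: "m = A n z + B n z + \<kappa>" using A_eq[OF z] by (simp add: \<kappa>_def)
    have BW: "B (Suc n) z * w (Suc n) z = B (Suc n) z + z + p z"
      using step[OF n(1) z] by (simp add: p_def algebra_simps)
    have "p z * (1 + (B (Suc n) z + z + p z) - B n z * w n z) =
        (w n z - 1) * (A n z * (1 + B (Suc n) z * w (Suc n) z - B n z * w n z))"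
      by (simp add: BW p_def)
    also have "\<dots> = (w n z - 1) * (\<kappa> * ((w n z - 1) * (B n z - A n z) - z))
        - (w n z - 1) * ((w n z - 1) * B n z * (m - B n z) - z * (B n z + \<nu>) / (w n z - 1))"
      unfolding dA'[OF z] \<kappa>_def[symmetric] by (rule right_diff_distrib)
    also have "(w n z - 1) * ((w n z - 1) * B n z * (m - B n z) - z * (B n z + \<nu>) / (w n z - 1)) =
        (w n z - 1)\<^sup>2 * B n z * (m - B n z) - z * (B n z + \<nu>)"
      using nz' by (simp add: right_diff_distrib[of _ _ "_ / _"] power2_eq_square)
    finally have "p z * (1 + (B (Suc n) z + z + p z) - B n z * w n z) =
        (w n z - 1) * (\<kappa> * ((w n z - 1) * (B n z - A n z) - z))
        - ((w n z - 1)\<^sup>2 * B n z * (m - B n z) - z * (B n z + \<nu>))" .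
    then have "p z * B (Suc n) z = (w n z - 1) * (\<kappa> * ((w n z - 1) * (B n z - A n z) - z))
        - ((w n z - 1)\<^sup>2 * B n z * (m - B n z) - z * (B n z + \<nu>))
        - p z * (1 + (z + p z) - B n z * w n z)"
      by (simp add: algebra_simps)
    moreover have a: "a = \<kappa> * w n z - (A n z + B n z + \<kappa>) - 2 * \<nu>"
      using \<kappa> m by simp
    ultimately show ?thesis
      unfolding p_def e_def m by (simp only: a) (simp add: algebra_simps power2_eq_square)
  qed
  show ?case
  proof
    fix z assume z: "z \<in> U"
    define b where "b = B (Suc n) z"
    define v where "v = w (Suc n) z"
    \<comment> \<open>\<open>dw0\<close> and \<open>dA0\<close> are \<open>z\<close> times the
      derivatives of \<open>w n\<close> and \<open>A n\<close>, written without \<open>B n\<close>;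
      \<open>dp\<close>, \<open>de\<close> and \<open>db\<close> are the corresponding quantities
      for \<open>p\<close>, \<open>e\<close> and \<open>B (Suc n)\<close>.\<close>
    define dw0 where "dw0 = w n z * (w n z - 1) * (m - 2 * A n z) - k * (w n z - 1) - z * w n z"
    define dA0 where "dA0 = - p z * (m - A n z) - z * (\<nu> + a + A n z) / (w n z - 1)"
    define dp where "dp = dA0 * (w n z - 1) + A n z * dw0"
    define de where "de = dA0 * w n z + A n z * dw0"
    define db where "db = b * (1 + A (Suc n) z * v - A n z * w n z)"
    have nz': "w n z \<noteq> 0" "w n z - 1 \<noteq> 0" "z \<noteq> 0" "A n z \<noteq> 0" "p z \<noteq> 0" "b \<noteq> 0"
      "v \<noteq> 0" "v - 1 \<noteq> 0"
      using nz[OF n(2) z] nz[OF Suc.prems z] nzB[OF n(1) z] by (auto simp: p_def b_def v_def)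
    have dw_eq: "w n z * ((w n z - 1) * (B n z - A n z) - z) =
        w n z * (w n z - 1) * (m - 2 * A n z) - k * (w n z - 1) - z * w n z"
      using IH(1)[OF z] by Groebner_Basis.algebra
    have dA_eq: "A n z * (1 + B (Suc n) z * w (Suc n) z - B n z * w n z) =
        - p z * (m - A n z) - z * (\<nu> + a + A n z) / (w n z - 1)"
    proof -
      have BW: "B (Suc n) z * w (Suc n) z = b + z + p z"
        using step[OF n(1) z] by (simp add: p_def b_def algebra_simps)
      have "(w n z - 1) * (A n z * (1 + B (Suc n) z * w (Suc n) z - B n z * w n z)) =
          p z * (1 + b + z + p z - B n z * w n z)"
        unfolding BW by (simp add: p_def algebra_simps)
      also have "\<dots> = (w n z - 1) * (- p z * (m - A n z)) - z * (\<nu> + a + A n z)"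
        using p_eq[OF z] IH(1)[OF z] k unfolding b_def[symmetric] p_def e_def by Groebner_Basis.algebra
      also have "\<dots> = (w n z - 1) * (- p z * (m - A n z) - z * (\<nu> + a + A n z) / (w n z - 1))"
        using nz' by (simp add: field_simps)
      finally show ?thesis using nz' by simp
    qed
    have dw': "(w n has_field_derivative dw0 / z) (at z)"
      using dw[OF n(2) z] unfolding dw_eq dw0_def .
    have dA'': "(A n has_field_derivative dA0 / z) (at z)"
      using dA[OF n(1) z] unfolding dA_eq dA0_def .
    have p': "(p has_field_derivative dp / z) (at z)"
      unfolding p_def using nz'
      by (auto intro!: derivative_eq_intros dw' dA'' simp: dp_def field_simps)
    have e': "(e has_field_derivative de / z) (at z)"
      unfolding e_def using nz'
      by (auto intro!: derivative_eq_intros dw' dA'' simp: de_def field_simps)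
    have b': "(B (Suc n) has_field_derivative db / z) (at z)"
      using dB[OF n(1) z] by (simp add: db_def b_def v_def)
    \<comment> \<open>The product is differentiated directly and through \<open>p_eq\<close>;
      uniqueness of the derivative gives \<open>D\<close>.\<close>
    have "((\<lambda>z. p z * B (Suc n) z) has_field_derivative (dp * b + p z * db) / z) (at z)"
      using nz' by (auto intro!: derivative_eq_intros p' b' simp: b_def field_simps)
    moreover have "((\<lambda>z. p z * B (Suc n) z) has_field_derivative
        (- (\<nu> + 1) * dp - (z + dp) * e z - (z + p z) * de) / z) (at z)"
    proof (rule has_field_derivative_transform_within_open[OF _ U z])
      show "((\<lambda>z. - (\<nu> + 1) * p z - (z + p z) * e z) has_field_derivative
          (- (\<nu> + 1) * dp - (z + dp) * e z - (z + p z) * de) / z) (at z)"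
        using nz' by (auto intro!: derivative_eq_intros p' e' simp: field_simps)
    qed (simp add: p_eq)
    ultimately have "(dp * b + p z * db) / z = (- (\<nu> + 1) * dp - (z + dp) * e z - (z + p z) * de) / z"
      by (rule DERIV_unique)
    then have D: "dp * b + p z * db = - (\<nu> + 1) * dp - (z + dp) * e z - (z + p z) * de"
      using nz' by simp
    have P: "p z * b = - (\<nu> + 1) * p z - (z + p z) * e z"
      using p_eq[OF z] by (simp add: b_def)
    have S: "b * (v - 1) = z + p z"
      using step[OF n(1) z] by (simp add: b_def v_def p_def)
    have dA0: "dA0 * (w n z - 1) = - p z * (m - A n z) * (w n z - 1) - z * (\<nu> + a + A n z)"
      using nz' by (simp add: dA0_def left_diff_distrib)
    have "p z * (p z * db) = p z * (p z * (z + p z) * (m - 1 - b) + z * b * e z)"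
      using D P dA0 unfolding k dp_def de_def dw0_def p_def e_def by Groebner_Basis.algebra
    then have db: "p z * db = p z * (z + p z) * (m - 1 - b) + z * b * e z"
      using nz' by simp
    \<comment> \<open>By definition \<open>db\<close> is affine in \<open>A (Suc n) z * v\<close>,
      so the formula just found determines that product. The outcome is the algebraic relation with
      \<open>m - 1\<close> and \<open>k + 1\<close> in place of \<open>m\<close> and
      \<open>k\<close>.\<close>
    have "p z * (b * ((A (Suc n) z + b) * v)) = p z * (b * ((m - 1) * v - (k + 1)))"
      using db[unfolded db_def] P S unfolding k e_def by Groebner_Basis.algebra
    then have C: "(A (Suc n) z + b) * v = (m - 1) * v - (k + 1)"
      using nz' by simp
    \<comment> \<open>Here \<open>P\<close> and \<open>S\<close> eliminate \<open>e\<close>: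
      together they give \<open>b * (v - 1) * e z = - p z * (b + \<nu> + 1)\<close>.\<close>
    have "p z * ((v - 1) * db) = p z * ((v - 1)\<^sup>2 * b * (m - 1 - b) - z * (b + (\<nu> + 1)))"
      using db P S by Groebner_Basis.algebra
    then have "(v - 1) * db = (v - 1)\<^sup>2 * b * (m - 1 - b) - z * (b + (\<nu> + 1))"
      using nz'(5) by (simp only: mult_cancel_left) simp
    then have "db = (v - 1) * b * (m - 1 - b) - z * (b + (\<nu> + 1)) / (v - 1)"
      using nz' by (simp add: field_simps power2_eq_square)
    with C b' show "(A (Suc n) z + B (Suc n) z) * w (Suc n) z =
        (N - of_nat (Suc n)) * w (Suc n) z - (N + of_nat (Suc n) + a) \<and>
      (B (Suc n) has_field_derivative ((w (Suc n) z - 1) * B (Suc n) z *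
        (N - of_nat (Suc n) - B (Suc n) z) - z * (B (Suc n) z + of_nat (Suc n)) /
        (w (Suc n) z - 1)) / z) (at z)"
      by (simp add: b_def v_def m_def k_def \<nu>_def algebra_simps)
  qed
qed

subsection \<open>Laguerre polynomials\<close>

lemma coeff_laguerre:
  "coeff (laguerre n a) i =
    (if i \<le> n then (- 1) ^ i / (fact i * fact (n - i)) * (\<Prod>l\<in>{i+1..n}. a + of_nat l) else 0)"
  unfolding laguerre_def coeff_sum by (simp add: if_distrib cong: if_cong)

text \<open>In the top coefficient the product over \<open>l\<close> is empty, so it does not depend
  on \<open>a\<close>. The degree is therefore \<open>n\<close> even when \<open>a\<close> is a
  negative integer and lower coefficients vanish.\<close>

lemma laguerre_nonzero: "laguerre n a \<noteq> 0"
  and degree_laguerre: "degree (laguerre n a) = n"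
proof -
  have c: "coeff (laguerre n a) n \<noteq> 0"
    by (simp add: coeff_laguerre)
  then show "laguerre n a \<noteq> 0" by auto
  show "degree (laguerre n a) = n"
    using le_degree[OF c] by (intro antisym degree_le) (auto simp: coeff_laguerre)
qed

text \<open>The left side is \<open>z\<close> times the derivative, which multiplies coefficient
  \<open>i\<close> by \<open>i\<close>. The claim becomes a two-term relation between coefficients
  of equal index.\<close>

lemma laguerre_ladder:
  "pCons 0 (pderiv (laguerre (Suc n) a)) =
    smult (of_nat (Suc n)) (laguerre (Suc n) a) - smult (of_nat (Suc n) + a) (laguerre n a)"
proof (rule poly_eqI)
  fix i
  let ?L = "laguerre (Suc n) a" and ?M = "laguerre n a"
  have "coeff (pCons 0 (pderiv ?L)) i = of_nat i * coeff ?L i"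
    by (cases i) (auto simp: coeff_pderiv)
  moreover have "(of_nat (Suc n) - of_nat i) * coeff ?L i = (of_nat (Suc n) + a) * coeff ?M i"
  proof (cases "i \<le> n")
    case True
    then obtain k where k: "n = i + k" using le_Suc_ex by blast
    have "(\<Prod>l\<in>{i+1..Suc n}. a + of_nat l) = (\<Prod>l\<in>{i+1..n}. a + of_nat l) * (a + of_nat (Suc n))"
      using True by (simp add: prod.atLeast_Suc_atMost_Suc_shift)
    moreover have "of_nat (Suc n) - of_nat i = (of_nat (Suc k) :: complex)" "Suc n - i = Suc k" "n - i = k"
      by (auto simp: k)
    ultimately show ?thesis
      using True by (simp add: coeff_laguerre fact_Suc[of k] del: fact_Suc of_nat_Suc)
  next
    case False
    then show ?thesis by (auto simp: coeff_laguerre le_Suc_eq)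
  qed
  ultimately show "coeff (pCons 0 (pderiv ?L)) i =
      coeff (smult (of_nat (Suc n)) ?L - smult (of_nat (Suc n) + a) ?M) i"
    by (simp add: algebra_simps del: of_nat_Suc)
qed

lemma pderiv_laguerre_Suc: "pderiv (laguerre (Suc n) a) = pderiv (laguerre n a) - laguerre n a"
proof (rule poly_eqI)
  fix i
  let ?Q = "\<Prod>l\<in>{i+2..n}. a + of_nat l"
  consider "Suc i \<le> n" | "i = n" | "i > n" by linarith
  then show "coeff (pderiv (laguerre (Suc n) a)) i = coeff (pderiv (laguerre n a) - laguerre n a) i"
  proof cases
    case 1
    then obtain k where k: "n = Suc i + k" using le_Suc_ex by blast
    \<comment> \<open>With \<open>x = i + 1\<close> and \<open>y = n - i\<close>, cancelling common
      factors reduces the comparison to \<open>(a + x + y) / y = 1 + (a + x) / y\<close>.\<close>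
    define x y :: complex where "x = of_nat (Suc i)" and "y = of_nat (Suc k)"
    have nz: "x \<noteq> 0" "y \<noteq> 0" unfolding x_def y_def by (simp_all del: of_nat_Suc)
    have prods: "(\<Prod>l\<in>{Suc i+1..Suc n}. a + of_nat l) = ?Q * (a + x + y)"
      using 1 by (simp add: x_def y_def k algebra_simps)
    have "{i+1..n} = insert (i + 1) {i+2..n}" using 1 by auto
    then have prods': "(\<Prod>l\<in>{i+1..n}. a + of_nat l) = (a + x) * ?Q"
      by (simp add: x_def)
    have diffs: "Suc n - Suc i = Suc k" "n - Suc i = k" "n - i = Suc k" by (auto simp: k)
    have facts: "fact (Suc i) = x * fact i" "fact (Suc k) = y * fact k"
      by (simp_all add: x_def y_def)
    have "coeff (laguerre (Suc n) a) (Suc i) =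
        (- 1) ^ Suc i / (x * fact i * (y * fact k)) * (?Q * (a + x + y))"
      unfolding coeff_laguerre prods diffs facts using 1 by simp
    moreover have "coeff (laguerre n a) (Suc i) = (- 1) ^ Suc i / (x * fact i * fact k) * ?Q"
      unfolding coeff_laguerre diffs facts using 1 by simp
    moreover have "coeff (laguerre n a) i = (- 1) ^ i / (fact i * (y * fact k)) * ((a + x) * ?Q)"
      unfolding coeff_laguerre diffs facts prods' using 1 by simp
    moreover have "x * (- s / (x * F * (y * G)) * (q * (a + x + y))) =
        x * (- s / (x * F * G) * q) - s / (F * (y * G)) * ((a + x) * q)"
      if "F \<noteq> 0" "G \<noteq> 0" for s F G q
      using nz that by (simp add: field_simps)
    from this[of "fact i" "fact k" "(-1) ^ i" ?Q]
    have "x * ((- 1) ^ Suc i / (x * fact i * (y * fact k)) * (?Q * (a + x + y))) =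
        x * ((- 1) ^ Suc i / (x * fact i * fact k) * ?Q)
        - (- 1) ^ i / (fact i * (y * fact k)) * ((a + x) * ?Q)"
      by simp
    ultimately show ?thesis
      unfolding coeff_diff coeff_pderiv x_def[symmetric] by simp
  next
    case 2
    then show ?thesis
      by (simp add: coeff_laguerre coeff_pderiv fact_Suc[of n] del: fact_Suc of_nat_Suc)
  next
    case 3
    then show ?thesis by (simp add: coeff_laguerre coeff_pderiv)
  qed
qed

subsection \<open>Logarithmic derivatives and the Toda chain\<close>

text \<open>Nonvanishing is built in, so that products and quotients simply add and subtract the
  values \<open>l\<close>.\<close>

definition has_logderiv :: "(complex \<Rightarrow> complex) \<Rightarrow> complex \<Rightarrow> complex \<Rightarrow> bool" where
  "has_logderiv f l z \<longleftrightarrow> f z \<noteq> 0 \<and> (f has_field_derivative f z * l) (at z)"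

lemma has_logderiv_mult:
  "has_logderiv f l z \<Longrightarrow> has_logderiv g m z \<Longrightarrow> has_logderiv (\<lambda>z. f z * g z) (l + m) z"
  by (auto simp: has_logderiv_def algebra_simps intro!: derivative_eq_intros)

lemma has_logderiv_divide:
  "has_logderiv f l z \<Longrightarrow> has_logderiv g m z \<Longrightarrow> has_logderiv (\<lambda>z. f z / g z) (l - m) z"
  by (auto simp: has_logderiv_def field_simps intro!: derivative_eq_intros)

lemma has_logderiv_ident: "z \<noteq> 0 \<Longrightarrow> has_logderiv (\<lambda>z. z) (1 / z) z"
  by (auto simp: has_logderiv_def)

lemma has_logderiv_poly:
  "poly p z \<noteq> 0 \<Longrightarrow> has_logderiv (poly p) (poly (pderiv p) z / poly p z) z"
  by (auto simp: has_logderiv_def intro!: derivative_eq_intros)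

text \<open>The Toda relations are applied to the powers of \<open>D\<close> on \<open>f\<close>
  with \<open>l = 0\<close> and to the powers of \<open>D - 1\<close> on \<open>g\<close> with
  \<open>l = 1\<close>. Both shifted sequences start at \<open>pderiv f\<close>, so by
  \<open>hankel_shift_deriv\<close> they share the determinants \<open>\<sigma>\<close>.\<close>

lemma hankel_pair_toda:
  fixes f g :: "complex poly"
  assumes fg: "pderiv f = pderiv g - g"
  defines "\<tau> \<equiv> hankel (\<lambda>j. (pderiv ^^ j) f)"
    and "\<rho> \<equiv> hankel (\<lambda>j. (pderiv ^^ j) g)"
    and "\<sigma> \<equiv> hankel (\<lambda>j. (pderiv ^^ j) (pderiv f))"
  shows "\<tau> (Suc (Suc n)) * \<sigma> n = \<tau> (Suc n) * pderiv (\<sigma> (Suc n)) - pderiv (\<tau> (Suc n)) * \<sigma> (Suc n)"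
    and "\<sigma> (Suc n) * \<tau> n = pderiv (\<tau> (Suc n)) * \<sigma> n - \<tau> (Suc n) * pderiv (\<sigma> n)"
    and "\<rho> (Suc (Suc n)) * \<sigma> n = \<rho> (Suc n) * pderiv (\<sigma> (Suc n)) - pderiv (\<rho> (Suc n)) * \<sigma> (Suc n)"
    and "\<sigma> (Suc n) * \<rho> n = pderiv (\<rho> (Suc n)) * \<sigma> n - \<rho> (Suc n) * pderiv (\<sigma> n) - \<rho> (Suc n) * \<sigma> n"
proof -
  let ?c = "\<lambda>j. (pderiv ^^ j) f" and ?d = "\<lambda>j. (shift_deriv 1 ^^ j) g"
  have c: "pderiv (?c j) = ?c (Suc j) + smult 0 (?c j)" for j by simp
  have d: "pderiv (?d j) = ?d (Suc j) + smult 1 (?d j)" for j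
    by (simp add: shift_deriv_def)
  have \<tau>: "\<tau> = hankel ?c" by (simp add: \<tau>_def)
  have \<sigma>: "\<sigma> = hankel (?c \<circ> Suc)"
    by (simp add: \<sigma>_def comp_def funpow_swap1)
  have \<rho>: "\<rho> = hankel ?d"
    by (rule ext) (simp add: \<rho>_def hankel_shift_deriv)
  have "shift_deriv 1 g = pderiv f"
    by (simp add: shift_deriv_def fg)
  then have "?d \<circ> Suc = (\<lambda>j. (shift_deriv 1 ^^ j) (pderiv f))"
    by (simp add: fun_eq_iff funpow_swap1)
  then have \<sigma>': "\<sigma> = hankel (?d \<circ> Suc)"
    by (intro ext) (simp add: \<sigma>_def hankel_shift_deriv)
  show "\<tau> (Suc (Suc n)) * \<sigma> n = \<tau> (Suc n) * pderiv (\<sigma> (Suc n)) - pderiv (\<tau> (Suc n)) * \<sigma> (Suc n)"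
    unfolding \<tau> \<sigma> by (rule hankel_toda_even[of ?c 0, OF c])
  show "\<sigma> (Suc n) * \<tau> n = pderiv (\<tau> (Suc n)) * \<sigma> n - \<tau> (Suc n) * pderiv (\<sigma> n)"
    unfolding \<tau> \<sigma> using hankel_toda_odd[of ?c 0, OF c] by simp
  show "\<rho> (Suc (Suc n)) * \<sigma> n = \<rho> (Suc n) * pderiv (\<sigma> (Suc n)) - pderiv (\<rho> (Suc n)) * \<sigma> (Suc n)"
    unfolding \<rho> \<sigma>' by (rule hankel_toda_even[of ?d 1, OF d])
  show "\<sigma> (Suc n) * \<rho> n = pderiv (\<rho> (Suc n)) * \<sigma> n - \<rho> (Suc n) * pderiv (\<sigma> n) - \<rho> (Suc n) * \<sigma> n"
    unfolding \<rho> \<sigma>' using hankel_toda_odd[of ?d 1, OF d] by simp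
qed

subsection \<open>Rational solutions\<close>

text \<open>The difference of the two sides is holomorphic on \<open>S\<close>, hence continuous,
  and it vanishes near each point of \<open>S\<close> except possibly at the point itself.\<close>

lemma PV_equation_at_extend:
  assumes S: "open S" "w holomorphic_on S" "\<And>z. z \<in> S \<Longrightarrow> z \<noteq> 0 \<and> w z \<noteq> 0 \<and> w z \<noteq> 1"
    and F: "finite F" "\<And>z. z \<in> S - F \<Longrightarrow> PV_equation_at \<alpha> \<beta> \<gamma> w z"
    and z: "z \<in> S"
  shows "PV_equation_at \<alpha> \<beta> \<gamma> w z"
proof -
  define E where "E = (\<lambda>z. deriv (deriv w) z -
       ((1 / (2 * w z) + 1 / (w z - 1)) * (deriv w z)\<^sup>2 - 1 / z * deriv w z
       + (w z - 1)\<^sup>2 * (\<alpha> * (w z)\<^sup>2 + \<beta>) / (z\<^sup>2 * w z)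
       + \<gamma> * w z / z - w z * (w z + 1) / (2 * (w z - 1))))"
  have E: "PV_equation_at \<alpha> \<beta> \<gamma> w z \<longleftrightarrow> E z = 0" for z
    by (simp add: PV_equation_at_def E_def)
  have "E holomorphic_on S"
    unfolding E_def using S by (intro holomorphic_intros) auto
  then have "E \<midarrow>z\<rightarrow> E z"
    using S(1) z by (meson continuous_on_eq_continuous_at holomorphic_on_imp_continuous_on isCont_def)
  moreover have "eventually (\<lambda>x. E x = 0) (at z)"
    unfolding eventually_at_topological
  proof (intro exI conjI ballI impI)
    show "open (S - (F - {z}))"
      using S(1) F(1) by (intro open_Diff finite_imp_closed) auto
    show "E x = 0" if "x \<in> S - (F - {z})" "x \<noteq> z" for x
      using F(2)[of x] that by (auto simp: E)
  qed (use z in auto)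
  then have "E \<midarrow>z\<rightarrow> 0"
    by (rule tendsto_eventually)
  ultimately have "E z = 0"
    by (rule LIM_unique)
  then show ?thesis by (simp add: E)
qed

text \<open>\<open>K\<close> may collect every polynomial whose zeros obstruct the derivation; the
  finitely many points lost are regained by continuity.\<close>

lemma PV_rational_solutionI:
  assumes "p \<noteq> 0" "q \<noteq> 0" "p \<noteq> q" "K \<noteq> 0"
    and K: "\<And>z. poly K z \<noteq> 0 \<Longrightarrow> PV_equation_at \<alpha> \<beta> \<gamma> (\<lambda>z. poly p z / poly q z) z"
  shows "PV_rational_solution \<alpha> \<beta> \<gamma> p q"
proof -
  define w where "w = (\<lambda>z. poly p z / poly q z)"
  define S where "S = {z. z \<noteq> 0 \<and> poly q z \<noteq> 0 \<and> w z \<noteq> 0 \<and> w z \<noteq> 1}"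
  define R where "R = [:0, 1:] * q * p * (p - q)"
  have S: "S = {z. poly R z \<noteq> 0}"
    by (auto simp: S_def R_def w_def)
  have "R \<noteq> 0" using assms by (simp add: R_def)
  then have fin: "finite (- S)"
    unfolding S by (simp add: Compl_eq poly_roots_finite)
  then have S_open: "open S"
    using finite_imp_closed[of "- S"] by (simp add: closed_def)
  have w_hol: "w holomorphic_on S"
    unfolding w_def by (intro holomorphic_intros) (auto simp: S_def)
  have "PV_equation_at \<alpha> \<beta> \<gamma> w z" if "z \<in> S" for z
  proof (rule PV_equation_at_extend[OF S_open w_hol _ _ _ that])
    show "finite {z. poly K z = 0}" using \<open>K \<noteq> 0\<close> by (rule poly_roots_finite)
  qed (use K in \<open>auto simp: S_def w_def\<close>)
  then show ?thesis
    using fin S_open w_hol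
    unfolding PV_rational_solution_def PV_solution_on_def Let_def w_def[symmetric] S_def[symmetric]
    by (auto simp: S_def)
qed

lemma hankel_pair_PV:
  fixes f g :: "complex poly" and a :: complex
  assumes fg: "pderiv f = pderiv g - g"
    and ladder: "pCons 0 (pderiv f) = smult (of_nat N) f - smult (of_nat N + a) g"
    and f: "f \<noteq> 0" "degree f = N" and g: "g \<noteq> 0" "Suc (degree g) = N"
    and "n < N"
  defines "\<tau> \<equiv> hankel (\<lambda>j. (pderiv ^^ j) f)" and "\<rho> \<equiv> hankel (\<lambda>j. (pderiv ^^ j) g)"
  shows "PV_rational_solution (1/2 * (of_nat N - of_nat n)\<^sup>2) (- 1/2 * (of_nat N + of_nat n + a)\<^sup>2) (a - 1)
    (\<rho> n * \<tau> (Suc n)) (\<tau> n * \<rho> (Suc n))"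
proof -
  define \<sigma> where "\<sigma> = hankel (\<lambda>j. (pderiv ^^ j) (pderiv f))"
  obtain M where M: "N = Suc M" using g(2) by auto
  have f': "pderiv f \<noteq> 0" "degree (pderiv f) = M"
    using f M by (auto simp: pderiv_eq_0_iff degree_pderiv)
  have \<tau>: "\<tau> j \<noteq> 0" "degree (\<tau> j) = j * (Suc N - j)" if "j \<le> Suc N" for j
    using hankel_pderiv_degree[of f j] f that by (simp_all add: \<tau>_def)
  have \<rho>: "\<rho> j \<noteq> 0" "degree (\<rho> j) = j * (N - j)" if "j \<le> N" for j
    using hankel_pderiv_degree[of g j] g that by (simp_all add: \<rho>_def)
  have \<sigma>: "\<sigma> j \<noteq> 0" if "j \<le> N" for j
    using hankel_pderiv_degree(1)[of "pderiv f" j] f' that M by (simp add: \<sigma>_def)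
  have base: "\<tau> 0 = 1" "\<tau> (Suc 0) = f" "\<rho> 0 = 1" "\<rho> (Suc 0) = g" "\<sigma> 0 = 1" "\<sigma> (Suc 0) = pderiv f"
    by (simp_all add: \<tau>_def \<rho>_def \<sigma>_def hankel_1)
  note toda = hankel_pair_toda[OF fg, folded \<tau>_def \<rho>_def \<sigma>_def]
  define P Q where "P j = \<rho> j * \<tau> (Suc j)" and "Q j = \<tau> j * \<rho> (Suc j)" for j
  \<comment> \<open>The degrees of \<open>P j\<close> and \<open>Q j\<close> differ by one, so
    \<open>w j\<close> is not identically 1.\<close>
  have PQ: "P j \<noteq> Q j" if "j < N" for j
  proof -
    obtain r where r: "N = Suc (j + r)" using \<open>j < N\<close> less_imp_Suc_add by blast
    have "degree (P j) = Suc (degree (Q j))"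
      using \<tau>[of j] \<tau>[of "Suc j"] \<rho>[of j] \<rho>[of "Suc j"] r
      by (simp add: P_def Q_def degree_mult_eq Suc_diff_le)
    then show ?thesis by auto
  qed
  \<comment> \<open>All indices enter, and not only \<open>n\<close>, because the induction along
    the chain divides by the determinants and by \<open>w j - 1\<close> at every earlier
    stage.\<close>
  define K where "K = [:0, 1:] * (\<Prod>j\<le>N. \<tau> j * \<sigma> j * \<rho> j) * (\<Prod>j<N. P j - Q j)"
  define U where "U = {z. poly K z \<noteq> 0}"
  have K: "K \<noteq> 0"
    using \<tau>(1) \<rho>(1) \<sigma> PQ by (auto simp: K_def)
  then have "finite (- U)"
    by (simp add: U_def Compl_eq poly_roots_finite)
  then have U: "open U"
    using finite_imp_closed[of "- U"] by (simp add: closed_def)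
  have nz: "z \<noteq> 0" "\<And>j. j \<le> N \<Longrightarrow> poly (\<tau> j) z \<noteq> 0" "\<And>j. j \<le> N \<Longrightarrow> poly (\<rho> j) z \<noteq> 0"
    "\<And>j. j \<le> N \<Longrightarrow> poly (\<sigma> j) z \<noteq> 0" "\<And>j. j < N \<Longrightarrow> poly (P j) z \<noteq> poly (Q j) z"
    if "z \<in> U" for z
    using that by (auto simp: U_def K_def poly_prod)

  define w where "w j z = poly (\<rho> j) z * poly (\<tau> (Suc j)) z / (poly (\<tau> j) z * poly (\<rho> (Suc j)) z)"
    for j z
  define A where "A j z = z * poly (\<sigma> (Suc j)) z * poly (\<tau> j) z / (poly (\<sigma> j) z * poly (\<tau> (Suc j)) z)"
    for j z
  \<comment> \<open>The value 0 at index 0 corresponds to a vanishing determinant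
    \<open>\<sigma>\<close> of index -1.\<close>
  define B where "B j z = (case j of 0 \<Rightarrow> 0 | Suc i \<Rightarrow>
    z * poly (\<sigma> i) z * poly (\<rho> (Suc j)) z / (poly (\<sigma> j) z * poly (\<rho> j) z))" for j z
  define tl rl sl where "tl j z = poly (pderiv (\<tau> j)) z / poly (\<tau> j) z"
    and "rl j z = poly (pderiv (\<rho> j)) z / poly (\<rho> j) z"
    and "sl j z = poly (pderiv (\<sigma> j)) z / poly (\<sigma> j) z" for j z

  \<comment> \<open>Divided by the two determinants that it differentiates, each bilinear relation
    becomes a difference of logarithmic derivatives; \<open>L1\<close> to \<open>L4\<close> are
    these four forms.\<close>
  have L1: "z * (sl j z - tl j z) = B j z * w j z" if "j \<le> M" "z \<in> U" for j z
  proof (cases j)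
    case 0
    then show ?thesis by (simp add: B_def sl_def tl_def base)
  next
    case (Suc i)
    have "sl j z - tl j z = poly (\<sigma> i) z * poly (\<tau> (Suc j)) z / (poly (\<tau> j) z * poly (\<sigma> j) z)"
      using arg_cong[OF toda(1)[of i], of "\<lambda>p. poly p z"] nz[OF that(2)] that(1) M
      by (simp add: Suc sl_def tl_def field_simps)
    then show ?thesis
      using nz[OF that(2)] that(1) M by (simp add: Suc B_def w_def)
  qed
  have L2: "z * (tl (Suc j) z - sl j z) = A j z" if "j \<le> M" "z \<in> U" for j z
  proof -
    have "tl (Suc j) z - sl j z =
        poly (\<sigma> (Suc j)) z * poly (\<tau> j) z / (poly (\<sigma> j) z * poly (\<tau> (Suc j)) z)"
      using arg_cong[OF toda(2)[of j], of "\<lambda>p. poly p z"] nz[OF that(2)] that(1) M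
      by (simp add: sl_def tl_def field_simps)
    then show ?thesis by (simp add: A_def)
  qed
  have L3: "z * (sl j z - rl j z) = B j z" if "j \<le> M" "z \<in> U" for j z
  proof (cases j)
    case 0
    then show ?thesis by (simp add: B_def sl_def rl_def base)
  next
    case (Suc i)
    have "sl j z - rl j z = poly (\<sigma> i) z * poly (\<rho> (Suc j)) z / (poly (\<sigma> j) z * poly (\<rho> j) z)"
      using arg_cong[OF toda(3)[of i], of "\<lambda>p. poly p z"] nz[OF that(2)] that(1) M
      by (simp add: Suc sl_def rl_def field_simps)
    then show ?thesis by (simp add: Suc B_def)
  qed
  have L4: "z * (rl (Suc j) z - sl j z) = z + A j z * w j z" if "j \<le> M" "z \<in> U" for j z
  proof -
    have "rl (Suc j) z - sl j z =
        1 + poly (\<sigma> (Suc j)) z * poly (\<rho> j) z / (poly (\<sigma> j) z * poly (\<rho> (Suc j)) z)"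
      using arg_cong[OF toda(4)[of j], of "\<lambda>p. poly p z"] nz[OF that(2)] that(1) M
      by (simp add: sl_def rl_def field_simps)
    then show ?thesis
      using nz[OF that(2)] that(1) M by (simp add: A_def w_def distrib_left)
  qed

  have logs: "has_logderiv (poly (\<tau> j)) (tl j z) z" "has_logderiv (poly (\<rho> j)) (rl j z) z"
    "has_logderiv (poly (\<sigma> j)) (sl j z) z" if "j \<le> N" "z \<in> U" for j z
    using nz[OF that(2)] that(1) by (auto simp: tl_def rl_def sl_def intro: has_logderiv_poly)
  note log_intros = has_logderiv_divide has_logderiv_mult has_logderiv_ident logs nz(1)
  have derivI: "(h has_field_derivative h z * d / z) (at z)"
    if "has_logderiv h l z" "z * l = d" "z \<noteq> 0" for h l d z
    using that by (auto simp: has_logderiv_def)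

  have chain: "\<forall>z\<in>U. (A n z + B n z) * w n z = (of_nat N - of_nat n) * w n z - (of_nat N + of_nat n + a) \<and>
    (B n has_field_derivative ((w n z - 1) * B n z * (of_nat N - of_nat n - B n z)
      - z * (B n z + of_nat n) / (w n z - 1)) / z) (at z)"
  proof (rule toda_chain[OF U, where M = M])
    show dw: "(w j has_field_derivative w j z * ((w j z - 1) * (B j z - A j z) - z) / z) (at z)"
      if "j \<le> M" "z \<in> U" for j z
    proof (rule derivI)
      show "has_logderiv (w j) (rl j z + tl (Suc j) z - (tl j z + rl (Suc j) z)) z"
        unfolding w_def using that M by (intro log_intros) auto
      show "z * (rl j z + tl (Suc j) z - (tl j z + rl (Suc j) z)) = (w j z - 1) * (B j z - A j z) - z"
        using L1[OF that] L2[OF that] L3[OF that] L4[OF that] by (simp add: algebra_simps)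
    qed (use nz that in auto)
    show "(A j has_field_derivative A j z * (1 + B (Suc j) z * w (Suc j) z - B j z * w j z) / z) (at z)"
      if "j < M" "z \<in> U" for j z
    proof (rule derivI)
      show "has_logderiv (A j) (1 / z + sl (Suc j) z + tl j z - (sl j z + tl (Suc j) z)) z"
        unfolding A_def using that M by (intro log_intros) auto
      show "z * (1 / z + sl (Suc j) z + tl j z - (sl j z + tl (Suc j) z)) =
          1 + B (Suc j) z * w (Suc j) z - B j z * w j z"
        using L1[of j z] L1[of "Suc j" z] nz(1)[of z] that by (simp add: algebra_simps)
    qed (use nz that in auto)
    show "(B (Suc j) has_field_derivative B (Suc j) z * (1 + A (Suc j) z * w (Suc j) z - A j z * w j z) / z) (at z)"
      if "j < M" "z \<in> U" for j z
    proof (rule derivI)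
      show "has_logderiv (B (Suc j)) (1 / z + sl j z + rl (Suc (Suc j)) z - (sl (Suc j) z + rl (Suc j) z)) z"
        unfolding B_def nat.case using that M by (intro log_intros) auto
      show "z * (1 / z + sl j z + rl (Suc (Suc j)) z - (sl (Suc j) z + rl (Suc j) z)) =
          1 + A (Suc j) z * w (Suc j) z - A j z * w j z"
        using L4[of j z] L4[of "Suc j" z] nz(1)[of z] that by (simp add: algebra_simps)
    qed (use nz that in auto)
    \<comment> \<open>Both sides equal \<open>z * (rl (Suc j) z - tl (Suc j) z)\<close>.\<close>
    show "B (Suc j) z * (w (Suc j) z - 1) = z + A j z * (w j z - 1)" if "j < M" "z \<in> U" for j z
      using L1[of "Suc j" z] L2[of j z] L3[of "Suc j" z] L4[of j z] that by (simp add: algebra_simps)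
    show "z \<noteq> 0 \<and> w j z \<noteq> 0 \<and> w j z \<noteq> 1 \<and> A j z \<noteq> 0" if "j \<le> M" "z \<in> U" for j z
      using nz[OF that(2)] that(1) M by (auto simp: w_def A_def P_def Q_def)
    show "B (Suc j) z \<noteq> 0" if "j < M" "z \<in> U" for j z
      using nz[OF that(2)] that(1) M by (auto simp: B_def)
    \<comment> \<open>At index 0 the left side is \<open>z\<close> times the derivative of
      \<open>f\<close> divided by \<open>g\<close>, so this is the ladder relation divided by
      \<open>g\<close>.\<close>
    show "A 0 z * w 0 z = of_nat N * w 0 z - (of_nat N + a)" if "z \<in> U" for z
    proof -
      have "poly f z \<noteq> 0" "poly g z \<noteq> 0"
        using nz(2,3)[OF that, of 1] M base by auto
      moreover have "z * poly (pderiv f) z = of_nat N * poly f z - (of_nat N + a) * poly g z"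
        using arg_cong[OF ladder, of "\<lambda>p. poly p z"] by simp
      ultimately show ?thesis
        by (simp add: A_def w_def base field_simps)
    qed
    show "n \<le> M" using \<open>n < N\<close> M by simp
    show "B 0 z = 0" for z by (simp add: B_def)
  qed
  have "PV_equation_at (1/2 * (of_nat N - of_nat n)\<^sup>2) (- 1/2 * (of_nat N + of_nat n + a)\<^sup>2) (a - 1) (w n) z"
    if z: "z \<in> U" for z
  proof (rule PV_from_system[OF U z, where B = "B n" and n = "of_nat n"])
    have n: "n \<le> M" using \<open>n < N\<close> M by simp
    show w: "z \<noteq> 0 \<and> w n z \<noteq> 0 \<and> w n z \<noteq> 1" if "z \<in> U" for z
      using nz[OF that] n M by (auto simp: w_def P_def Q_def)
    show "(w n has_field_derivative w n z * ((w n z - 1) *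
        (2 * B n z - (of_nat N - of_nat n) + (of_nat N + of_nat n + a) / w n z) - z) / z) (at z)"
      if "z \<in> U" for z
    proof (rule derivI)
      show "has_logderiv (w n) (rl n z + tl (Suc n) z - (tl n z + rl (Suc n) z)) z"
        unfolding w_def using that n M by (intro log_intros) auto
      have BA: "2 * B n z - (of_nat N - of_nat n) + (of_nat N + of_nat n + a) / w n z = B n z - A n z"
        using chain that w[OF that] by (simp add: field_simps)
      show "z * (rl n z + tl (Suc n) z - (tl n z + rl (Suc n) z)) = (w n z - 1) *
          (2 * B n z - (of_nat N - of_nat n) + (of_nat N + of_nat n + a) / w n z) - z"
        unfolding BA using L1[OF n that] L2[OF n that] L3[OF n that] L4[OF n that] by (simp add: algebra_simps)
    qed (use nz that in auto)
  qed (use chain in auto)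
  moreover have "w n = (\<lambda>z. poly (\<rho> n * \<tau> (Suc n)) z / poly (\<tau> n * \<rho> (Suc n)) z)"
    by (simp add: w_def fun_eq_iff)
  moreover have "\<rho> n * \<tau> (Suc n) \<noteq> \<tau> n * \<rho> (Suc n)"
    using PQ \<open>n < N\<close> by (simp add: P_def Q_def)
  ultimately show ?thesis
    using K \<tau>(1) \<rho>(1) \<open>n < N\<close> by (intro PV_rational_solutionI[of _ _ K]) (auto simp: U_def)
qed

section \<open>Specialisation to generalised Laguerre polynomials\<close>

lemma gen_laguerre_hankel:
  "gen_laguerre m n \<mu> = hankel (\<lambda>j. (pderiv ^^ j) (laguerre (nat (m + int n)) (\<mu> + 1))) n"
  by (simp add: gen_laguerre_def hankel_def col_det_def)

text \<open>All four determinants are built from the Laguerre polynomials of degree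
  \<open>m + n\<close> and \<open>m + n - 1\<close>, so \<open>hankel_pair_PV\<close> applies with
  \<open>N = m + n\<close> and \<open>a = \<mu> + 1\<close>. The case \<open>n = 0\<close> is
  included.\<close>

lemma gen_laguerre_PV:
  fixes m n :: nat
  assumes "m \<ge> 1"
  shows "PV_rational_solution (1/2 * (of_nat m)\<^sup>2) (- 1/2 * (of_nat m + 2 * of_nat n + 1 + \<mu>)\<^sup>2) \<mu>
    (gen_laguerre (int m - 1) n \<mu> * gen_laguerre (int m - 1) (n + 1) \<mu>)
    (gen_laguerre (int m) n \<mu> * gen_laguerre (int m - 2) (n + 1) \<mu>)"
proof -
  obtain M where M: "m + n = Suc M" using assms by (cases "m + n") auto
  have idx: "nat (int m - 1 + int n) = M" "nat (int m - 1 + int (Suc n)) = Suc M"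
    "nat (int m + int n) = Suc M" "nat (int m - 2 + int (Suc n)) = M"
    using M by auto
  have PV: "PV_rational_solution (1/2 * (of_nat (Suc M) - of_nat n)\<^sup>2)
      (- 1/2 * (of_nat (Suc M) + of_nat n + (\<mu> + 1))\<^sup>2) (\<mu> + 1 - 1)
      (gen_laguerre (int m - 1) n \<mu> * gen_laguerre (int m - 1) (n + 1) \<mu>)
      (gen_laguerre (int m) n \<mu> * gen_laguerre (int m - 2) (n + 1) \<mu>)"
    unfolding Suc_eq_plus1[symmetric, of n] gen_laguerre_hankel idx
    by (rule hankel_pair_PV[OF pderiv_laguerre_Suc laguerre_ladder])
      (use assms M in \<open>auto simp: laguerre_nonzero degree_laguerre\<close>)
  have params: "of_nat (Suc M) - of_nat n = (of_nat m :: complex)"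
    "of_nat (Suc M) + of_nat n + (\<mu> + 1) = of_nat m + 2 * of_nat n + 1 + \<mu>"
    unfolding M[symmetric] by simp_all
  show ?thesis
    using PV unfolding params by simp
qed

theorem theorem4p6:
  fixes \<mu> :: complex
  shows "(\<forall>(m::nat) (n::nat). m \<ge> 1 \<longrightarrow> n \<ge> 1 \<longrightarrow>
            PV_rational_solution
              (1/2 * (of_nat m)\<^sup>2)
              (- 1/2 * (of_nat m + 2 * of_nat n + 1 + \<mu>)\<^sup>2)
              \<mu>
              (gen_laguerre (int m - 1) n \<mu> * gen_laguerre (int m - 1) (n + 1) \<mu>)
              (gen_laguerre (int m) n \<mu> * gen_laguerre (int m - 2) (n + 1) \<mu>))
       \<and> (\<forall>m::nat. m \<ge> 1 \<longrightarrow>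
            (\<forall>z. poly (gen_laguerre (int m - 1) 1 \<mu>) z / poly (gen_laguerre (int m - 2) 1 \<mu>) z
                 = poly (laguerre m (\<mu> + 1)) z / poly (laguerre (m - 1) (\<mu> + 1)) z)
          \<and> PV_rational_solution
              (1/2 * (of_nat m)\<^sup>2)
              (- 1/2 * (of_nat m + 1 + \<mu>)\<^sup>2)
              \<mu>
              (gen_laguerre (int m - 1) 1 \<mu>)
              (gen_laguerre (int m - 2) 1 \<mu>))"
proof (intro conjI allI impI)
  fix m n :: nat assume "m \<ge> 1"
  then show "PV_rational_solution (1/2 * (of_nat m)\<^sup>2) (- 1/2 * (of_nat m + 2 * of_nat n + 1 + \<mu>)\<^sup>2) \<mu>
      (gen_laguerre (int m - 1) n \<mu> * gen_laguerre (int m - 1) (n + 1) \<mu>)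
      (gen_laguerre (int m) n \<mu> * gen_laguerre (int m - 2) (n + 1) \<mu>)"
    by (rule gen_laguerre_PV)
next
  fix m :: nat and z assume "m \<ge> 1"
  then have "nat (int m - 1 + int 1) = m" "nat (int m - 2 + int 1) = m - 1" by auto
  then show "poly (gen_laguerre (int m - 1) 1 \<mu>) z / poly (gen_laguerre (int m - 2) 1 \<mu>) z =
      poly (laguerre m (\<mu> + 1)) z / poly (laguerre (m - 1) (\<mu> + 1)) z"
    unfolding gen_laguerre_hankel by (simp add: hankel_1)
next
  fix m :: nat assume "m \<ge> 1"
  \<comment> \<open>For \<open>n = 0\<close> the factors of size 0 are empty determinants, equal to
    1.\<close>
  from gen_laguerre_PV[OF this, of 0 \<mu>]
  show "PV_rational_solution (1/2 * (of_nat m)\<^sup>2) (- 1/2 * (of_nat m + 1 + \<mu>)\<^sup>2) \<mu>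
      (gen_laguerre (int m - 1) 1 \<mu>) (gen_laguerre (int m - 2) 1 \<mu>)"
    by (simp add: gen_laguerre_hankel[of _ 0])
qed

end
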